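(* Let $n\ge 1$, let $q$ be either $1$ or a prime power, and let $G\subseteq \mathrm{Aut}(\mathcal{P}(n,q))$. Suppose that the prime $p$ is coprime to $|G|$ and to $q$. Put $\pi:=\pi(p,q)$. For $k\in\mathbb{Z}$ let $N_k$ be the number of orbits of $G$ on the set of elements of rank $k$ in $\mathcal{P}(n,q)$. Then $$[N_m]_\pi\ \ge\ [N_{m-1}]_\pi\ \ge\ [N_{m-2}]_\pi\ \ge\ \cdots\ \ge\ [N_{m-s}]_\pi\ \ge\ 0,$$ where $m=\lfloor\frac n2\rfloor$ and $s=\lfloor\frac{\pi}{2}\rfloor$.
   Context: For a prime power $q$, $\mathcal{P}(n,q)$ is the poset of all subspaces of $\mathrm{GF}_q^{\,n}$ ordered by inclusion, ranked by dimension; the paper takes its automorphism group to be $\mathrm{Aut}(\mathcal{P}(n,q))=\mathrm{P\Gamma L}(n,q)$. For $q=1$, $\mathcal{P}(n,1)$ is the lattice of all subsets of an $n$-element set, ranked by cardinality, with automorphism group $\mathrm{Sym}_n$. For a prime $p$ and an integer $q$ coprime to $p$, $\pi(p,q)$ is the least integer $\pi>0$ such that $1+q+q^2+\cdots+q^{\pi-1}\equiv 0\pmod p$; in particular $\pi(p,1)=p$. For an integer function $k\mapsto N_k$ on $\mathbb{Z}$ with finitely many nonzero values, $[N_k]_\pi:=\sum_{t\in\mathbb{Z}}N_{k+t\pi}$. Here $N_k=0$ for $k<0$ and $k>n$. *)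

theory Defs
  imports
    "HOL-Analysis.Analysis"
    "HOL-Algebra.Bij"
    "HOL-Algebra.Group_Action"
    "HOL-Algebra.Sym_Groups"
    "HOL-Number_Theory.Cong"
    "HOL-Number_Theory.Prime_Powers"
    "HOL-Library.Groups_Big_Fun"
begin

definition field_automorphism :: "('a::field \<Rightarrow> 'a) \<Rightarrow> bool" where
  "field_automorphism \<sigma> \<longleftrightarrow>
     bij \<sigma> \<and> (\<forall>x y. \<sigma> (x + y) = \<sigma> x + \<sigma> y) \<and> (\<forall>x y. \<sigma> (x * y) = \<sigma> x * \<sigma> y)"

definition semilinear_bij :: "('a::field ^ 'n \<Rightarrow> 'a ^ 'n) \<Rightarrow> bool" where
  "semilinear_bij f \<longleftrightarrow>
     bij f \<and> (\<forall>x y. f (x + y) = f x + f y) \<and>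
     (\<exists>\<sigma>. field_automorphism \<sigma> \<and> (\<forall>c x. f (c *s x) = \<sigma> c *s f x))"

definition subspaces :: "('a::field ^ 'n) set set" where
  "subspaces = {U. vec.subspace U}"

text \<open>The projective semilinear group is taken in its role as the automorphism group of
  the poset of subspaces, i.e. as the group of permutations of the subspaces that are induced by
  semilinear bijections. For dimension at least 2 two semilinear bijections induce the same
  permutation iff they differ by a scalar, so that this is the quotient of the semilinear group by
  the scalars; in dimension 1 it is the (trivial) image of that quotient.\<close>

definition PGammaL :: "(('a::field ^ 'n) set \<Rightarrow> ('a ^ 'n) set) monoid" where
  "PGammaL = BijGroup subspaces
     \<lparr>carrier := {restrict (\<lambda>U. f ` U) subspaces | f. semilinear_bij f}\<rparr>"

lemma semilinear_bij_id: "semilinear_bij id"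
  unfolding semilinear_bij_def field_automorphism_def by (auto intro!: exI[of _ id])

lemma semilinear_bij_comp:
  assumes "semilinear_bij f" "semilinear_bij g"
  shows "semilinear_bij (f \<circ> g)"
proof -
  obtain \<sigma> where s: "field_automorphism \<sigma>" "\<And>c x. f (c *s x) = \<sigma> c *s f x"
    using assms(1) unfolding semilinear_bij_def by blast
  obtain \<tau> where t: "field_automorphism \<tau>" "\<And>c x. g (c *s x) = \<tau> c *s g x"
    using assms(2) unfolding semilinear_bij_def by blast
  have "field_automorphism (\<sigma> \<circ> \<tau>)"
    using s t by (simp add: field_automorphism_def bij_comp)
  moreover have "\<forall>c x. (f \<circ> g) (c *s x) = (\<sigma> \<circ> \<tau>) c *s (f \<circ> g) x"
    by (simp add: s t)
  ultimately show ?thesis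
    using assms unfolding semilinear_bij_def by (auto intro: bij_comp)
qed

lemma semilinear_bij_inv:
  assumes "semilinear_bij f"
  shows "semilinear_bij (inv_into UNIV f)"
proof -
  have bf: "bij f" and add: "\<And>x y. f (x + y) = f x + f y"
    using assms unfolding semilinear_bij_def by blast+
  obtain \<sigma> where s: "bij \<sigma>" "\<And>x y. \<sigma> (x + y) = \<sigma> x + \<sigma> y"
      "\<And>x y. \<sigma> (x * y) = \<sigma> x * \<sigma> y" "\<And>c x. f (c *s x) = \<sigma> c *s f x"
    using assms unfolding semilinear_bij_def field_automorphism_def by blast
  have ff: "f (inv_into UNIV f x) = x" "inv_into UNIV f (f x) = x" for x
    using bf by (simp_all add: bij_is_surj surj_f_inv_f bij_is_inj)
  have ss: "\<sigma> (inv_into UNIV \<sigma> x) = x" "inv_into UNIV \<sigma> (\<sigma> x) = x" for x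
    using s(1) by (simp_all add: bij_is_surj surj_f_inv_f bij_is_inj)
  have "field_automorphism (inv_into UNIV \<sigma>)"
    unfolding field_automorphism_def
    using s(1) bij_imp_bij_inv[OF s(1)] by (metis s(2,3) ss)
  moreover have "inv_into UNIV f (c *s x) = inv_into UNIV \<sigma> c *s inv_into UNIV f x" for c x
    by (metis ff s(4) ss(1))
  moreover have "inv_into UNIV f (x + y) = inv_into UNIV f x + inv_into UNIV f y" for x y
    by (metis add ff)
  ultimately show ?thesis
    using bij_imp_bij_inv[OF bf] unfolding semilinear_bij_def by blast
qed

lemma semilinear_bij_image_subspace:
  assumes "semilinear_bij f" "U \<in> subspaces"
  shows "f ` U \<in> subspaces"
proof -
  have add: "\<And>x y. f (x + y) = f x + f y"
    using assms unfolding semilinear_bij_def by blast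
  obtain \<sigma> where s: "bij \<sigma>" "\<And>c x. f (c *s x) = \<sigma> c *s f x"
    using assms unfolding semilinear_bij_def field_automorphism_def by blast
  have U: "0 \<in> U" "\<And>x y. x \<in> U \<Longrightarrow> y \<in> U \<Longrightarrow> x + y \<in> U" "\<And>c x. x \<in> U \<Longrightarrow> c *s x \<in> U"
    using assms(2) by (auto simp: subspaces_def vec.subspace_def)
  have "f 0 = 0" using add[of 0 0] by simp
  then have "0 \<in> f ` U" using U(1) by force
  moreover have "x + y \<in> f ` U" if "x \<in> f ` U" "y \<in> f ` U" for x y
    using that U(2) add by (auto simp flip: add)
  moreover have "c *s x \<in> f ` U" if x: "x \<in> f ` U" for c x
  proof -
    obtain d where "\<sigma> d = c" using s(1) by (metis bij_pointE)
    then show ?thesis using x U(3) s(2) by (metis (no_types, lifting) imageE imageI)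
  qed
  ultimately show ?thesis by (simp add: subspaces_def vec.subspace_def)
qed

lemma restrict_image_in_Bij:
  assumes "semilinear_bij f"
  shows "restrict (\<lambda>U. f ` U) subspaces \<in> Bij subspaces"
proof -
  have bf: "bij f" using assms unfolding semilinear_bij_def by blast
  have "bij_betw (\<lambda>U. f ` U) subspaces subspaces"
    by (rule bij_betw_byWitness[where f' = "\<lambda>U. inv_into UNIV f ` U"])
      (use bf in \<open>auto simp: image_inv_f_f bij_is_inj image_f_inv_f bij_is_surj
         intro: semilinear_bij_image_subspace assms semilinear_bij_inv\<close>)
  then show ?thesis by (simp add: Bij_def)
qed

lemma subgroup_PGammaL: "subgroup (carrier PGammaL) (BijGroup subspaces)"
proof -
  interpret B: group "BijGroup (subspaces :: ('a ^ 'b) set set)" by (rule group_BijGroup)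
  let ?r = "\<lambda>f::'a ^ 'b \<Rightarrow> 'a ^ 'b. restrict (\<lambda>U. f ` U) subspaces"
  have car: "carrier (BijGroup (subspaces :: ('a ^ 'b) set set)) = Bij subspaces"
    by (simp add: BijGroup_def)
  have mul: "?r f \<otimes>\<^bsub>BijGroup subspaces\<^esub> ?r g = ?r (f \<circ> g)"
    if "semilinear_bij f" "semilinear_bij g" for f g
    using that by (auto simp: BijGroup_def restrict_image_in_Bij compose_def fun_eq_iff
        image_comp semilinear_bij_image_subspace)
  have one: "?r id = \<one>\<^bsub>BijGroup subspaces\<^esub>" by (simp add: BijGroup_def)
  show ?thesis
  proof (rule B.subgroupI)
    show "carrier PGammaL \<subseteq> carrier (BijGroup (subspaces :: ('a ^ 'b) set set))"
      by (auto simp: PGammaL_def car restrict_image_in_Bij)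
    show "carrier (PGammaL :: (('a ^ 'b) set \<Rightarrow> ('a ^ 'b) set) monoid) \<noteq> {}"
      using semilinear_bij_id by (auto simp: PGammaL_def)
    fix a b :: "('a ^ 'b) set \<Rightarrow> ('a ^ 'b) set"
    assume a: "a \<in> carrier PGammaL"
    then obtain f where f: "semilinear_bij f" "a = ?r f" by (auto simp: PGammaL_def)
    have "inv_into UNIV f \<circ> f = id"
      using f(1) by (simp add: semilinear_bij_def bij_is_inj)
    then have "?r (inv_into UNIV f) \<otimes>\<^bsub>BijGroup subspaces\<^esub> a = \<one>\<^bsub>BijGroup subspaces\<^esub>"
      using mul[OF semilinear_bij_inv[OF f(1)] f(1)] f(2) one by simp
    then have "inv\<^bsub>BijGroup subspaces\<^esub> a = ?r (inv_into UNIV f)"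
      using f by (intro B.inv_equality) (auto simp: car restrict_image_in_Bij semilinear_bij_inv)
    then show "inv\<^bsub>BijGroup subspaces\<^esub> a \<in> carrier PGammaL"
      using semilinear_bij_inv[OF f(1)] by (auto simp: PGammaL_def)
    assume "b \<in> carrier PGammaL"
    then obtain g where g: "semilinear_bij g" "b = ?r g" by (auto simp: PGammaL_def)
    have "?r h \<in> carrier PGammaL" if "semilinear_bij h" for h
      using that by (auto simp: PGammaL_def)
    from this[OF semilinear_bij_comp[OF f(1) g(1)]]
    show "a \<otimes>\<^bsub>BijGroup subspaces\<^esub> b \<in> carrier PGammaL"
      unfolding f(2) g(2) mul[OF f(1) g(1)] .
  qed
qed

lemma group_PGammaL: "group (PGammaL :: (('a::field ^ 'n) set \<Rightarrow> ('a ^ 'n) set) monoid)"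
  using group.subgroup_imp_group[OF group_BijGroup subgroup_PGammaL]
  by (simp add: PGammaL_def)

text \<open>The number of orbits on the elements of rank \<open>k\<close> of the ranked set \<open>P\<close>, where the group
  acts through \<open>\<phi>\<close>; it is 0 for negative \<open>k\<close>.\<close>

definition rank_orbits ::
    "('g, 'm) monoid_scheme \<Rightarrow> ('g \<Rightarrow> 'v \<Rightarrow> 'v) \<Rightarrow> 'v set \<Rightarrow> ('v \<Rightarrow> nat) \<Rightarrow> int \<Rightarrow> int" where
  "rank_orbits G \<phi> P rk k = int (card (orbits G {x \<in> P. int (rk x) = k} \<phi>))"

definition boolean_orbits :: "nat \<Rightarrow> (nat \<Rightarrow> nat) set \<Rightarrow> int \<Rightarrow> int" where
  "boolean_orbits n G =
     rank_orbits (sym_group n\<lparr>carrier := G\<rparr>) (\<lambda>g A. g ` A) (Pow {1..n}) card"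

definition subspace_orbits :: "(('a::field ^ 'n) set \<Rightarrow> ('a ^ 'n) set) set \<Rightarrow> int \<Rightarrow> int" where
  "subspace_orbits G =
     rank_orbits (PGammaL\<lparr>carrier := G\<rparr>) (\<lambda>g U. g U) subspaces vec.dim"

definition pi_pq :: "nat \<Rightarrow> int \<Rightarrow> nat" where
  "pi_pq p q = (LEAST r. r > 0 \<and> [(\<Sum>i<r. q ^ i) = 0] (mod int p))"

text \<open>\<^const>\<open>Sum_any\<close> sums over the support, which is finite if \<open>N\<close> has finite
  support and \<open>r > 0\<close>.\<close>

definition wrapped :: "(int \<Rightarrow> int) \<Rightarrow> nat \<Rightarrow> int \<Rightarrow> int" where
  "wrapped N r k = Sum_any (\<lambda>t::int. N (k + t * int r))"

definition wrapped_chain :: "(int \<Rightarrow> int) \<Rightarrow> nat \<Rightarrow> int \<Rightarrow> nat \<Rightarrow> bool" where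
  "wrapped_chain N r m s \<longleftrightarrow>
     (\<forall>i<s. wrapped N r (m - int i) \<ge> wrapped N r (m - int (Suc i))) \<and>
     wrapped N r (m - int s) \<ge> 0"

end

theory Submission
  imports Defs "HOL-Number_Theory.Residues"
begin

text \<open>
  Let \<open>M\<^sub>k\<close> be the functions modulo \<open>p\<close> on the elements of rank \<open>k\<close>, and let
  \<open>D : M\<^sub>k \<rightarrow> M\<^sub>k\<^sub>-\<^sub>1\<close> sum a function over the covers of an element, so that \<open>D\<^sup>\<pi> = 0\<close>. For
  \<open>a + b = \<pi>\<close> the sequence \<open>M\<^sub>j\<^sub>+\<^sub>b \<rightarrow> M\<^sub>j \<rightarrow> M\<^sub>j\<^sub>-\<^sub>a\<close> of powers of \<open>D\<close> is exact at \<open>M\<^sub>j\<close>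
  whenever \<open>2 j + b \<le> n\<close> or \<open>2 j - a \<ge> n\<close>. Averaging over \<open>G\<close> keeps the sequence exact on
  invariant functions, and counting these along the complex with \<open>b = 1\<close>, in which every second
  term is exact, gives the inequality.

  Exactness is proved by induction on \<open>n\<close>. With respect to a hyperplane \<open>H\<close>, a function on the whole
  lattice decomposes into functions on \<open>H\<close> paired with functions on the elements outside \<open>H\<close>. The
  latter split into those depending only on the intersection with \<open>H\<close>, which yield a
  \<open>q\<close>-analogue of the tensor product of the complex of \<open>H\<close> with a string of length two, and a
  part that embeds into the complexes of the subspaces \<open>Y \<inter> H\<close> for the other hyperplanes \<open>Y\<close>
  (for \<open>q = 1\<close> that part vanishes).
\<close>

section \<open>The numbers $1 + q + \cdots + q^{r-1}$\<close>

text \<open>Write \<open>D\<close> for \<open>down\<close> and \<open>[i]\<close> for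
  \<open>gauss_int q i\<close>, which is \<open>i\<close> at \<open>q = 1\<close>. Exactness is
  proved only outside the band \<open>n - b < 2 j < n + a\<close>, and this region is what makes the
  induction close. Passing to some \<open>Y \<inter> H\<close> lowers \<open>n\<close> by two and
  \<open>j\<close> by one, which preserves both bounds. Passing to \<open>H\<close> lowers
  \<open>n\<close> by one only; there the bounds survive at \<open>(a + 1, b - 1, j)\<close> and at
  \<open>(a - 1, b + 1, j - 1)\<close>. Hence all splittings \<open>a + b = per\<close> are treated
  together, although the count itself takes \<open>b = 1\<close>. The equations on pairs are
  solvable because, for \<open>a, b > 0\<close>, both \<open>[a]\<close> and \<open>[b]\<close> are
  invertible modulo \<open>p\<close> by minimality of \<open>per\<close>, whereas
  \<open>[b] + q^b [a] = [per]\<close> vanishes. Values stay integers, compared modulo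
  \<open>p\<close>; dimensions over the prime field appear as exponents of \<open>p\<close> in
  cardinalities of finite sets of functions.\<close>

definition gauss_int :: "nat \<Rightarrow> nat \<Rightarrow> nat" where
  "gauss_int q r = (\<Sum>i<r. q ^ i)"

lemma gauss_int_simps [simp]:
  "gauss_int q 0 = 0" "gauss_int q (Suc r) = gauss_int q r + q ^ r"
  by (simp_all add: gauss_int_def)

lemma gauss_int_Suc_left: "gauss_int q (Suc r) = 1 + q * gauss_int q r"
  by (simp only: gauss_int_def sum.lessThan_Suc_shift sum_distrib_left) simp

lemma of_nat_gauss_int: "int (gauss_int q r) = (\<Sum>i<r. int q ^ i)"
  by (simp add: gauss_int_def)

lemma gauss_int_1 [simp]: "gauss_int (Suc 0) r = r"
  by (simp add: gauss_int_def)

lemma gauss_int_mult: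
  assumes "q > 0"
  shows "gauss_int q r * (q - 1) = q ^ r - 1"
proof -
  obtain k where k: "q = Suc k" using assms gr0_implies_Suc by blast
  have "Suc (gauss_int (Suc k) r * k) = Suc k ^ r"
    by (induction r) (simp_all add: algebra_simps)
  then show ?thesis unfolding k by (metis diff_Suc_1)
qed

text \<open>This makes the \<open>LEAST\<close> in \<open>pi_pq\<close> attained. If
  \<open>q\<close> is 1 modulo \<open>p\<close>, then \<open>r = p\<close> works. Otherwise Fermat
  shows that \<open>p\<close> divides \<open>q^(p-1) - 1 = (q - 1) [p-1]\<close>, and it does not
  divide the first factor.\<close>

lemma gauss_int_dvd_exists:
  fixes p q :: nat
  assumes "prime p" "coprime p q"
  shows "\<exists>r>0. p dvd gauss_int q r"
proof (cases "[q = 1] (mod p)")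
  case True
  have "[(\<Sum>i<p. q ^ i) = (\<Sum>i<p. 1 ^ i)] (mod p)"
    by (intro cong_sum cong_pow True)
  then have "[gauss_int q p = 0] (mod p)" by (simp add: gauss_int_def cong_def)
  then show ?thesis using assms(1) prime_gt_0_nat[of p] by (auto simp: cong_0_iff)
next
  case False
  have "\<not> p dvd q" using assms by (metis coprime_absorb_left not_prime_unit)
  then have "[q ^ (p - 1) = 1] (mod p)" using fermat_theorem assms by blast
  then have "int p dvd int (q ^ (p - 1)) - 1"
    by (metis cong_iff_dvd_diff cong_int_iff of_nat_1)
  also have "int (q ^ (p - 1)) - 1 = (int q - 1) * int (gauss_int q (p - 1))"
    by (simp add: gauss_int_def power_diff_1_eq lessThan_atLeast0)
  finally have "int p dvd int q - 1 \<or> int p dvd int (gauss_int q (p - 1))"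
    using assms by (simp add: prime_dvd_mult_iff)
  moreover have "\<not> int p dvd int q - 1"
    using False by (metis cong_iff_dvd_diff cong_int_iff of_nat_1)
  ultimately have "p dvd gauss_int q (p - 1)" by auto
  moreover have "p - 1 > 0" using prime_gt_1_nat[OF assms(1)] by simp
  ultimately show ?thesis by blast
qed

lemma dvd_lin2:
  fixes p :: int
  assumes "p dvd a" "p dvd b" "z = x * a + y * b"
  shows "p dvd z"
  using assms by simp

section \<open>Modular geometries\<close>

text \<open>A common frame for subsets (\<open>q = 1\<close>) and for subspaces over a field of size
  \<open>q\<close>. The meet is intersection in both cases; the join is a parameter because it is
  the union in one case and the sum in the other. \<open>card_atoms\<close> ties \<open>q\<close> to
  the lattice.\<close>

locale modular_geometry =
  fixes L :: "'v set set" and rk :: "'v set \<Rightarrow> nat"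
    and jn :: "'v set \<Rightarrow> 'v set \<Rightarrow> 'v set" and q :: nat
  assumes finite_L: "finite L"
    and bot: "\<exists>z\<in>L. rk z = 0 \<and> (\<forall>x\<in>L. z \<subseteq> x)"
    and inter_L: "x \<in> L \<Longrightarrow> y \<in> L \<Longrightarrow> x \<inter> y \<in> L"
    and jn_L: "x \<in> L \<Longrightarrow> y \<in> L \<Longrightarrow> jn x y \<in> L"
    and jn_upper: "x \<in> L \<Longrightarrow> y \<in> L \<Longrightarrow> x \<union> y \<subseteq> jn x y"
    and jn_least: "x \<in> L \<Longrightarrow> y \<in> L \<Longrightarrow> z \<in> L \<Longrightarrow> x \<subseteq> z \<Longrightarrow> y \<subseteq> z \<Longrightarrow> jn x y \<subseteq> z"
    and modular: "x \<in> L \<Longrightarrow> y \<in> L \<Longrightarrow> rk (jn x y) + rk (x \<inter> y) = rk x + rk y"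
    and rk_strict: "x \<in> L \<Longrightarrow> y \<in> L \<Longrightarrow> x \<subset> y \<Longrightarrow> rk x < rk y"
    and card_atoms: "x \<in> L \<Longrightarrow> y \<in> L \<Longrightarrow> x \<subseteq> y \<Longrightarrow>
      card {z \<in> L. x \<subseteq> z \<and> z \<subseteq> y \<and> rk z = Suc (rk x)} = gauss_int q (rk y - rk x)"
    and q_pos: "q > 0"
begin

lemma rk_mono: "x \<in> L \<Longrightarrow> y \<in> L \<Longrightarrow> x \<subseteq> y \<Longrightarrow> rk x \<le> rk y"
  using rk_strict[of x y] by (cases "x = y") (auto simp: psubset_eq)

lemma rk_eq: "x \<in> L \<Longrightarrow> y \<in> L \<Longrightarrow> x \<subseteq> y \<Longrightarrow> rk x = rk y \<Longrightarrow> x = y"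
  using rk_strict[of x y] by auto

lemma finite_sub [simp]: "finite {x \<in> L. P x}"
  using finite_L by simp

section \<open>Hyperplanes of an element, and counts relative to one of them\<close>

definition coatoms :: "'v set \<Rightarrow> 'v set set" where
  "coatoms X = {Y \<in> L. Y \<subseteq> X \<and> Suc (rk Y) = rk X}"

lemma finite_coatoms [simp]: "finite (coatoms X)"
  by (simp add: coatoms_def)

text \<open>Take an element of maximal rank above \<open>x\<close> and properly inside
  \<open>X\<close>. By \<open>card_atoms\<close> it has a cover inside \<open>X\<close>, and
  maximality forces that cover to be \<open>X\<close>.\<close>

lemma coatom_exists:
  assumes "x \<in> L" "X \<in> L" "x \<subset> X"
  obtains H where "H \<in> coatoms X" "x \<subseteq> H"
proof -
  define S where "S = {y \<in> L. x \<subseteq> y \<and> y \<subset> X}"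
  have "finite S" "x \<in> S" using assms by (auto simp: S_def)
  then obtain y where y: "y \<in> S" "\<And>z. z \<in> S \<Longrightarrow> rk z \<le> rk y"
    using obtains_MAX[of S rk] by (metis Max_ge empty_iff finite_imageI imageI)
  have "rk y < rk X" using y assms by (auto simp: S_def intro: rk_strict)
  then have "gauss_int q (rk X - rk y) \<noteq> 0"
    by (cases "rk X - rk y") (auto simp: gauss_int_Suc_left simp del: gauss_int_simps(2))
  then have "card {z \<in> L. y \<subseteq> z \<and> z \<subseteq> X \<and> rk z = Suc (rk y)} \<noteq> 0"
    using y assms by (subst card_atoms) (auto simp: S_def)
  then have "{z \<in> L. y \<subseteq> z \<and> z \<subseteq> X \<and> rk z = Suc (rk y)} \<noteq> {}"
    by (metis card.empty)
  then obtain z where z: "z \<in> L" "y \<subseteq> z" "z \<subseteq> X" "rk z = Suc (rk y)" by blast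
  have "z = X"
  proof (rule ccontr)
    assume "z \<noteq> X"
    then have "z \<in> S" using z y by (auto simp: S_def)
    then show False using y(2) z by fastforce
  qed
  then show ?thesis using z y that[of y] by (auto simp: S_def coatoms_def)
qed

text \<open>The join of \<open>x\<close> and \<open>H\<close> has rank above \<open>rk H\<close> and
  at most \<open>rk H + 1\<close>; the modular law transfers this difference of one to
  \<open>x\<close> and \<open>x \<inter> H\<close>.\<close>

lemma rk_inter_coatom:
  assumes "X \<in> L" "H \<in> coatoms X" "x \<in> L" "x \<subseteq> X" "\<not> x \<subseteq> H"
  shows "rk x = Suc (rk (x \<inter> H))"
proof -
  have H: "H \<in> L" "H \<subseteq> X" "Suc (rk H) = rk X" using assms by (auto simp: coatoms_def)
  have J: "jn x H \<in> L" "jn x H \<subseteq> X" using assms H by (auto intro: jn_L dest: jn_least[of x H X])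
  have "H \<subset> jn x H" using assms H jn_upper[of x H] by auto
  then have "rk H < rk (jn x H)" using rk_strict H J by blast
  moreover have "rk (jn x H) \<le> rk X" using J assms rk_mono by blast
  ultimately show ?thesis using modular[of x H] assms H by auto
qed

lemma inter_coatom_cover:
  assumes "X \<in> L" "H \<in> coatoms X" "x \<in> L" "x \<subseteq> X" "\<not> x \<subseteq> H" "z \<in> L" "z \<subseteq> H"
  shows "x \<inter> H = z \<longleftrightarrow> z \<subseteq> x \<and> rk x = Suc (rk z)"
proof -
  have "H \<in> L" using assms by (auto simp: coatoms_def)
  then have "x \<inter> H \<in> L" using assms inter_L by auto
  then show ?thesis using rk_inter_coatom[OF assms(1-5)] rk_eq[of z "x \<inter> H"] assms by auto
qed

text \<open>By \<open>inter_coatom_cover\<close> these are the covers of \<open>z\<close> inside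
  \<open>Y\<close> that are not inside \<open>Y \<inter> H\<close>, which gives
  \<open>[e+1] - [e] = q^e\<close>.\<close>

lemma card_lifts:
  assumes X: "X \<in> L" "H \<in> coatoms X" and Y: "Y \<in> L" "Y \<subseteq> X" "\<not> Y \<subseteq> H"
    and z: "z \<in> L" "z \<subseteq> Y \<inter> H" and rkY: "rk Y = Suc (rk z + e)"
  shows "card {x \<in> L. x \<subseteq> Y \<and> \<not> x \<subseteq> H \<and> x \<inter> H = z} = q ^ e"
proof -
  have H: "H \<in> L" "H \<subseteq> X" using X by (auto simp: coatoms_def)
  have K: "Y \<inter> H \<in> L" "rk Y = Suc (rk (Y \<inter> H))" 
    using rk_inter_coatom[OF X Y] Y H inter_L by auto
  let ?A = "{x \<in> L. z \<subseteq> x \<and> x \<subseteq> Y \<and> rk x = Suc (rk z)}"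
  let ?B = "{x \<in> L. z \<subseteq> x \<and> x \<subseteq> Y \<inter> H \<and> rk x = Suc (rk z)}"
  have "{x \<in> L. x \<subseteq> Y \<and> \<not> x \<subseteq> H \<and> x \<inter> H = z} = ?A - ?B" (is "?lhs = _")
  proof (rule Set.set_eqI)
    fix x
    have "x \<in> L \<and> x \<subseteq> Y \<and> \<not> x \<subseteq> H \<longrightarrow> (x \<inter> H = z \<longleftrightarrow> z \<subseteq> x \<and> rk x = Suc (rk z))"
      using inter_coatom_cover[OF X, of x z] z Y by (meson le_inf_iff order_trans)
    then show "x \<in> ?lhs \<longleftrightarrow> x \<in> ?A - ?B"
      unfolding mem_Collect_eq Diff_iff le_inf_iff by argo
  qed
  then have "card ?lhs = card ?A - card ?B"
    by (simp only:, intro card_Diff_subset) auto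
  also have "card ?A = gauss_int q (Suc e)"
    using card_atoms[of z Y] Y z rkY by auto
  also have "card ?B = gauss_int q e"
  proof -
    have "rk (Y \<inter> H) - rk z = e" using K rkY by simp
    then show ?thesis using card_atoms[of z "Y \<inter> H"] K z by simp
  qed
  finally show ?thesis by simp
qed

text \<open>The dual of \<open>card_atoms\<close>, derived from it. Fix a coatom \<open>H\<close>
  above \<open>x\<close>: every other coatom meets \<open>H\<close> in a coatom of \<open>H\<close>,
  each of these arises \<open>q\<close> times, and \<open>1 + q [r] = [r+1]\<close>.\<close>

lemma card_coatoms:
  assumes "x \<in> L" "X \<in> L" "x \<subseteq> X"
  shows "card {Y \<in> coatoms X. x \<subseteq> Y} = gauss_int q (rk X - rk x)"
  using assms
proof (induction "rk X - rk x" arbitrary: X)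
  case 0
  then have "x = X" using rk_mono[of x X] rk_eq[of x X] by simp
  then have "{Y \<in> coatoms X. x \<subseteq> Y} = {}" by (auto simp: coatoms_def)
  then show ?case using 0 by (metis card.empty gauss_int_simps(1))
next
  case (Suc r)
  then have "x \<subset> X" by auto
  then obtain H where H: "H \<in> coatoms X" "x \<subseteq> H" using coatom_exists Suc by metis
  then have HL: "H \<in> L" "H \<subseteq> X" "rk X = Suc (rk H)" by (auto simp: coatoms_def)
  let ?S = "{Y \<in> coatoms X. x \<subseteq> Y}" and ?T = "{K \<in> coatoms H. x \<subseteq> K}"
  have r: "r = rk H - rk x" using Suc(2) HL by auto
  have nle: "\<not> Y \<subseteq> H" if "Y \<in> coatoms X" "Y \<noteq> H" for Y
  proof
    assume "Y \<subseteq> H"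
    moreover have "Y \<in> L" "rk Y = rk H" using that HL by (simp_all add: coatoms_def)
    ultimately show False using rk_eq[of Y H] HL that by blast
  qed
  have img: "(\<lambda>Y. Y \<inter> H) ` (?S - {H}) \<subseteq> ?T"
  proof (rule image_subsetI)
    fix Y assume "Y \<in> ?S - {H}"
    then have Y: "Y \<in> coatoms X" "x \<subseteq> Y" "Y \<noteq> H" by auto
    then have "\<not> Y \<subseteq> H" "Y \<in> L" "Y \<subseteq> X" using nle[of Y] by (auto simp: coatoms_def)
    then have "rk Y = Suc (rk (Y \<inter> H))"
      using Suc.prems H by (intro rk_inter_coatom) auto
    then show "Y \<inter> H \<in> ?T" using Y H HL inter_L by (auto simp: coatoms_def)
  qed
  have fib: "card {Y \<in> ?S - {H}. Y \<inter> H = K} = q" if K: "K \<in> ?T" for K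
  proof -
    have "{Y \<in> ?S - {H}. Y \<inter> H = K} = {Y \<in> L. Y \<subseteq> X \<and> \<not> Y \<subseteq> H \<and> Y \<inter> H = K}"
    proof (rule Set.set_eqI)
      fix Y
      have "Y \<in> ?S - {H} \<and> Y \<inter> H = K \<longleftrightarrow> Y \<in> coatoms X \<and> \<not> Y \<subseteq> H \<and> Y \<inter> H = K"
        using K nle[of Y] by auto
      also have "\<dots> \<longleftrightarrow> Y \<in> L \<and> Y \<subseteq> X \<and> \<not> Y \<subseteq> H \<and> Y \<inter> H = K"
        using K HL inter_coatom_cover[OF Suc.prems(2) H(1), of Y K] by (auto simp: coatoms_def)
      finally show "Y \<in> {Y \<in> ?S - {H}. Y \<inter> H = K} \<longleftrightarrow>
        Y \<in> {Y \<in> L. Y \<subseteq> X \<and> \<not> Y \<subseteq> H \<and> Y \<inter> H = K}" by simp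
    qed
    also have "card \<dots> = q ^ 1"
      using K HL Suc.prems H by (intro card_lifts[of X]) (auto simp: coatoms_def)
    finally show ?thesis by simp
  qed
  have "card ?T * q = (\<Sum>K\<in>?T. card {Y \<in> ?S - {H}. Y \<inter> H = K})" using fib by simp
  also have "\<dots> = card (?S - {H})"
    using sum.group[OF _ _ img, where h="\<lambda>_. 1::nat"] by simp
  finally have "card (?S - {H}) = card ?T * q" by simp
  moreover have "card ?S = Suc (card (?S - {H}))"
    using H by (intro card.remove) auto
  ultimately have "card ?S = Suc (card ?T * q)" by simp
  also have "card ?T = gauss_int q r"
    using Suc.hyps(1)[of H] r Suc.prems HL H by auto
  finally have "card ?S = gauss_int q (Suc r)"
    by (simp only: gauss_int_Suc_left) (simp add: mult.commute)
  then show ?case using Suc(2) by simp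
qed

section \<open>The operator \<open>D\<close> and homogeneous functions\<close>

definition down :: "('v set \<Rightarrow> int) \<Rightarrow> 'v set \<Rightarrow> int" where
  "down f y = (if y \<in> L then \<Sum>x | x \<in> L \<and> y \<subseteq> x \<and> rk x = Suc (rk y). f x else 0)"

lemma down_add: "down (\<lambda>x. f x + g x) = (\<lambda>x. down f x + down g x)"
  by (auto simp: down_def sum.distrib)

lemma down_diff: "down (\<lambda>x. f x - g x) = (\<lambda>x. down f x - down g x)"
  by (auto simp: down_def sum_subtractf)

lemma down_scale: "down (\<lambda>x. c * f x) = (\<lambda>x. c * down f x)"
  by (auto simp: down_def sum_distrib_left)

lemma down_0 [simp]: "down (\<lambda>x. 0) = (\<lambda>x. 0)"
  by (auto simp: down_def)

lemma downs_add: "(down ^^ i) (\<lambda>x. f x + g x) = (\<lambda>x. (down ^^ i) f x + (down ^^ i) g x)"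
  by (induction i) (simp_all add: down_add)

lemma downs_diff: "(down ^^ i) (\<lambda>x. f x - g x) = (\<lambda>x. (down ^^ i) f x - (down ^^ i) g x)"
  by (induction i) (simp_all add: down_diff)

lemma downs_scale: "(down ^^ i) (\<lambda>x. c * f x) = (\<lambda>x. c * (down ^^ i) f x)"
  by (induction i) (simp_all add: down_scale)

lemma downs_0 [simp]: "(down ^^ i) (\<lambda>x. 0) = (\<lambda>x. 0)"
  by (induction i) simp_all

lemma downs_downs: "(down ^^ i) ((down ^^ j) f) = (down ^^ (i + j)) f"
  by (simp add: funpow_add)

text \<open>The values are integers standing for residues; congruence enters later through
  \<open>eqv\<close>. The degree is an integer, so that negative degrees, which contain only the
  zero function, need no special treatment.\<close>

definition chain_space :: "'v set \<Rightarrow> int \<Rightarrow> ('v set \<Rightarrow> int) set" where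
  "chain_space X j = {f. \<forall>x. f x \<noteq> 0 \<longrightarrow> x \<in> L \<and> x \<subseteq> X \<and> int (rk x) = j}"

lemma chain_spaceD: "f \<in> chain_space X j \<Longrightarrow> f x \<noteq> 0 \<Longrightarrow> x \<in> L \<and> x \<subseteq> X \<and> int (rk x) = j"
  by (auto simp: chain_space_def)

lemma chain_space_0 [simp]: "(\<lambda>x. 0) \<in> chain_space X j"
  by (auto simp: chain_space_def)

lemma chain_space_add: "f \<in> chain_space X j \<Longrightarrow> g \<in> chain_space X j \<Longrightarrow> (\<lambda>x. f x + g x) \<in> chain_space X j"
  unfolding chain_space_def mem_Collect_eq by (metis add.right_neutral)

lemma chain_space_diff: "f \<in> chain_space X j \<Longrightarrow> g \<in> chain_space X j \<Longrightarrow> (\<lambda>x. f x - g x) \<in> chain_space X j"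
  unfolding chain_space_def mem_Collect_eq by (metis diff_0_right)

lemma chain_space_scale: "f \<in> chain_space X j \<Longrightarrow> (\<lambda>x. c * f x) \<in> chain_space X j"
  by (auto simp: chain_space_def)

lemma down_chain_space:
  assumes "f \<in> chain_space X j" shows "down f \<in> chain_space X (j - 1)"
proof -
  have "x \<in> L \<and> x \<subseteq> X \<and> int (rk x) = j - 1" if "down f x \<noteq> 0" for x
  proof -
    have x: "x \<in> L" using that by (auto simp: down_def split: if_splits)
    then have "(\<Sum>y | y \<in> L \<and> x \<subseteq> y \<and> rk y = Suc (rk x). f y) \<noteq> 0"
      using that by (simp add: down_def)
    then obtain y where "x \<subseteq> y" "rk y = Suc (rk x)" "f y \<noteq> 0"
      by (rule sum.not_neutral_contains_not_neutral) blast
    then show ?thesis using chain_spaceD[OF assms, of y] x by auto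
  qed
  then show ?thesis by (auto simp: chain_space_def)
qed

lemma downs_chain_space:
  assumes "f \<in> chain_space X j" "k = j - int i" shows "(down ^^ i) f \<in> chain_space X k"
  using assms(2)
proof (induction i arbitrary: k)
  case 0 then show ?case using assms by simp
next
  case (Suc i)
  have "k = j - int i - 1" using Suc.prems by simp
  then show ?case using down_chain_space[OF Suc.IH[OF refl]] by simp
qed

section \<open>Splitting along a hyperplane\<close>

lemma down_sum:
  "down (\<lambda>x. \<Sum>Y\<in>A. F Y x) = (\<lambda>x. \<Sum>Y\<in>A. down (F Y) x)"
proof
  fix y
  show "down (\<lambda>x. \<Sum>Y\<in>A. F Y x) y = (\<Sum>Y\<in>A. down (F Y) y)"
    unfolding down_def by (cases "y \<in> L") (simp_all, rule sum.swap)
qed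

lemma downs_sum:
  "(down ^^ i) (\<lambda>x. \<Sum>Y\<in>A. F Y x) = (\<lambda>x. \<Sum>Y\<in>A. (down ^^ i) (F Y) x)"
  by (induction i) (simp_all add: down_sum)

definition supported :: "'v set \<Rightarrow> ('v set \<Rightarrow> int) \<Rightarrow> bool" where
  "supported X f \<longleftrightarrow> (\<forall>x. f x \<noteq> 0 \<longrightarrow> x \<in> L \<and> x \<subseteq> X)"

lemma supportedD: "supported X f \<Longrightarrow> \<not> (x \<in> L \<and> x \<subseteq> X) \<Longrightarrow> f x = 0"
  by (auto simp: supported_def)

lemma chain_space_supported: "f \<in> chain_space X j \<Longrightarrow> supported X f"
  by (auto simp: supported_def chain_space_def)

lemma supported_down:
  assumes "supported X f"
  shows "supported X (down f)"
  unfolding supported_def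
proof (intro allI impI)
  fix x assume x: "down f x \<noteq> 0"
  then have xL: "x \<in> L" by (auto simp: down_def split: if_splits)
  then have "(\<Sum>y | y \<in> L \<and> x \<subseteq> y \<and> rk y = Suc (rk x). f y) \<noteq> 0"
    using x by (simp add: down_def)
  then obtain y where "x \<subseteq> y" "f y \<noteq> 0"
    by (rule sum.not_neutral_contains_not_neutral) blast
  then show "x \<in> L \<and> x \<subseteq> X" using assms xL by (auto simp: supported_def)
qed

lemma supported_downs: "supported X f \<Longrightarrow> supported X ((down ^^ i) f)"
  by (induction i) (auto intro: supported_down)

lemma supported_scale: "supported X f \<Longrightarrow> supported X (\<lambda>x. c x * f x)"
  by (auto simp: supported_def)

lemma supported_add: "supported X f \<Longrightarrow> supported X g \<Longrightarrow> supported X (\<lambda>x. f x + g x)"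
  unfolding supported_def by (metis add.right_neutral)

text \<open>Any set containing \<open>x\<close> is outside \<open>H\<close> as well. So outside
  \<open>H\<close> a function may be replaced, before applying \<open>D\<close>, by one that agrees
  with it there.\<close>

lemma down_off:
  assumes "\<And>x. \<not> x \<subseteq> H \<Longrightarrow> f x = g x" "\<not> x \<subseteq> H"
  shows "down f x = down g x"
  unfolding down_def using assms by (auto intro!: sum.cong)

text \<open>The interval isomorphism of a modular lattice; its inverse joins with \<open>x\<close>.
  The modular law computes the ranks, and comparable elements of equal rank coincide.\<close>

lemma bij_betw_inter_coatom:
  assumes X: "X \<in> L" "H \<in> coatoms X" and Y: "Y \<in> L" "Y \<subseteq> X"
    and x: "x \<in> L" "x \<subseteq> Y" "\<not> x \<subseteq> H"
  shows "bij_betw (\<lambda>y. y \<inter> H) {y \<in> L. x \<subseteq> y \<and> y \<subseteq> Y \<and> rk y = Suc (rk x)}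
    {w \<in> L. x \<inter> H \<subseteq> w \<and> w \<subseteq> Y \<inter> H \<and> rk w = Suc (rk (x \<inter> H))}"
    (is "bij_betw _ ?A ?B")
proof -
  have H: "H \<in> L" using X by (auto simp: coatoms_def)
  have r: "rk y = Suc (rk (y \<inter> H))" if "y \<in> L" "y \<subseteq> Y" "x \<subseteq> y" for y
    using that x Y by (intro rk_inter_coatom[OF X]) auto
  have fwd: "y \<inter> H \<in> ?B" "jn x (y \<inter> H) = y" if y: "y \<in> ?A" for y
  proof -
    show B: "y \<inter> H \<in> ?B"
      using y r[of y] r[of x] x H by (auto intro: inter_L)
    have J: "jn x (y \<inter> H) \<in> L" "jn x (y \<inter> H) \<subseteq> y"
      using y x H by (auto intro: jn_L inter_L dest: jn_least[of x "y \<inter> H" y])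
    have "x \<inter> (y \<inter> H) = x \<inter> H" using y by auto
    then have "rk (jn x (y \<inter> H)) = rk y"
      using modular[of x "y \<inter> H"] B y r[of x] x by auto
    then show "jn x (y \<inter> H) = y" using rk_eq[of _ y] J y by auto
  qed
  have bwd: "jn x w \<in> ?A" "jn x w \<inter> H = w" if w: "w \<in> ?B" for w
  proof -
    have J: "jn x w \<in> L" "jn x w \<subseteq> Y" "x \<subseteq> jn x w" "w \<subseteq> jn x w"
      using w x Y jn_upper[of x w] by (auto intro: jn_L dest: jn_least[of x w Y])
    have "x \<inter> w = x \<inter> H" using w by auto
    then have rj: "rk (jn x w) = Suc (rk x)"
      using modular[of x w] w x r[of x] by auto
    then show "jn x w \<in> ?A" using J by auto
    have "jn x w \<inter> H \<in> L" "rk (jn x w \<inter> H) = rk w"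
      using r[of "jn x w"] r[of x] rj J w x H by (auto intro: inter_L)
    then show "jn x w \<inter> H = w" using rk_eq[of w "jn x w \<inter> H"] J w by auto
  qed
  show ?thesis
  proof (rule bij_betw_byWitness[where f' = "jn x"])
    show "\<forall>y\<in>?A. jn x (y \<inter> H) = y" by (intro ballI fwd(2))
    show "\<forall>w\<in>?B. jn x w \<inter> H = w" by (intro ballI bwd(2))
    show "(\<lambda>y. y \<inter> H) ` ?A \<subseteq> ?B" by (intro image_subsetI fwd(1))
    show "jn x ` ?B \<subseteq> ?A" by (intro image_subsetI bwd(1))
  qed
qed

section \<open>Pairs: a function on \<open>H\<close>, and one pulled back from \<open>H\<close> to
  the elements outside it\<close>

definition lift :: "'v set \<Rightarrow> 'v set \<Rightarrow> ('v set \<Rightarrow> int) \<Rightarrow> 'v set \<Rightarrow> int" where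
  "lift Y H g x = (if x \<in> L \<and> x \<subseteq> Y \<and> \<not> x \<subseteq> H then g (x \<inter> H) else 0)"

text \<open>Covers of \<open>x\<close> inside \<open>Y\<close> match covers of
  \<open>x \<inter> H\<close> inside \<open>Y \<inter> H\<close>. For \<open>x\<close> inside
  \<open>H\<close> the right side vanishes while the left may not; that contribution is computed in
  \<open>down_lift_below\<close>.\<close>

lemma down_lift:
  assumes X: "X \<in> L" "H \<in> coatoms X" and Y: "Y \<in> L" "Y \<subseteq> X"
    and g: "supported (Y \<inter> H) g" and x: "\<not> x \<subseteq> H"
  shows "down (lift Y H g) x = lift Y H (down g) x"
proof (cases "x \<in> L \<and> x \<subseteq> Y")
  case False
  have "lift Y H g y = 0" if "x \<subseteq> y" "\<not> x \<subseteq> Y" for y using that by (auto simp: lift_def)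
  then show ?thesis using False by (auto simp: down_def lift_def[of Y H "down g"])
next
  case True
  have H: "H \<in> L" using X by (auto simp: coatoms_def)
  have "down (lift Y H g) x =
      (\<Sum>y | y \<in> L \<and> x \<subseteq> y \<and> y \<subseteq> Y \<and> rk y = Suc (rk x). g (y \<inter> H))"
  proof -
    have "\<not> y \<subseteq> H" if "x \<subseteq> y" for y using that x by blast
    then show ?thesis
      unfolding down_def if_P[OF conjunct1[OF True]]
      by (intro sum.mono_neutral_cong_right) (auto simp: lift_def split: if_splits)
  qed
  also have "\<dots> = (\<Sum>w | w \<in> L \<and> x \<inter> H \<subseteq> w \<and> w \<subseteq> Y \<inter> H \<and> rk w = Suc (rk (x \<inter> H)). g w)"
    using sum.reindex_bij_betw[OF bij_betw_inter_coatom[OF X Y, of x], of g] True x by auto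
  also have "\<dots> = down g (x \<inter> H)"
    unfolding down_def using True H supportedD[OF g]
    by (auto simp: inter_L intro!: sum.mono_neutral_left)
  finally show ?thesis using True x by (simp add: lift_def)
qed

lemma downs_lift:
  assumes X: "X \<in> L" "H \<in> coatoms X" and Y: "Y \<in> L" "Y \<subseteq> X"
    and g: "supported (Y \<inter> H) g" and x: "\<not> x \<subseteq> H"
  shows "(down ^^ i) (lift Y H g) x = lift Y H ((down ^^ i) g) x"
  using x
proof (induction i arbitrary: x)
  case (Suc i)
  \<comment> \<open>The iterate is known to be a lift only outside \<open>H\<close>, which is all
    that \<open>down_off\<close> asks for.\<close>
  have "down ((down ^^ i) (lift Y H g)) x = down (lift Y H ((down ^^ i) g)) x"
    using Suc by (intro down_off[of H]) auto
  also have "\<dots> = lift Y H (down ((down ^^ i) g)) x"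
    by (intro down_lift[OF X Y] supported_downs g Suc.prems)
  finally show ?case by simp
qed simp

text \<open>The covers of \<open>x\<close> outside \<open>H\<close> are the elements with trace
  \<open>x\<close> in \<open>H\<close>. All carry the value \<open>g x\<close>, and
  \<open>card_lifts\<close> counts them.\<close>

lemma down_lift_below:
  assumes X: "X \<in> L" "H \<in> coatoms X" and g: "supported H g" and x: "x \<in> L" "x \<subseteq> H"
  shows "down (lift X H g) x = int q ^ (rk H - rk x) * g x"
proof -
  have H: "H \<in> L" "H \<subseteq> X" "rk X = Suc (rk H)" using X by (auto simp: coatoms_def)
  have "rk X = Suc (rk x + (rk H - rk x))" using H x rk_mono[of x H] by auto
  then have c: "card {y \<in> L. y \<subseteq> X \<and> \<not> y \<subseteq> H \<and> y \<inter> H = x} = q ^ (rk H - rk x)"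
    using x H X rk_mono[of X H] by (intro card_lifts[OF X]) auto
  have "down (lift X H g) x = (\<Sum>y | y \<in> L \<and> y \<subseteq> X \<and> \<not> y \<subseteq> H \<and> y \<inter> H = x. g x)"
  proof -
    have "y \<inter> H = x \<longleftrightarrow> x \<subseteq> y \<and> rk y = Suc (rk x)"
      if "y \<in> L" "y \<subseteq> X" "\<not> y \<subseteq> H" for y
      using inter_coatom_cover[OF X that x] .
    then show ?thesis
      unfolding down_def if_P[OF x(1)]
      by (intro sum.mono_neutral_cong_right) (auto simp: lift_def split: if_splits)
  qed
  then show ?thesis using c by simp
qed

text \<open>For \<open>x\<close> inside \<open>H\<close> the weight is the factor from
  \<open>down_lift_below\<close>: the number of elements outside \<open>H\<close> with trace
  \<open>x\<close>.\<close>

definition weigh :: "'v set \<Rightarrow> ('v set \<Rightarrow> int) \<Rightarrow> 'v set \<Rightarrow> int" where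
  "weigh H g x = int q ^ (rk H - rk x) * g x"

lemma supported_weigh: "supported H g \<Longrightarrow> supported H (weigh H g)"
  by (auto simp: supported_def weigh_def)

lemma chain_space_weigh: "g \<in> chain_space H j \<Longrightarrow> weigh H g \<in> chain_space H j"
  by (auto simp: chain_space_def weigh_def)

text \<open>A cover has codimension one less in \<open>H\<close>, so exchanging the weighting with
  \<open>D\<close> costs a factor \<open>q\<close>. The support condition ensures that the truncated
  \<open>rk H - rk x\<close> really drops by one.\<close>

lemma weigh_down:
  assumes "H \<in> L" "supported H g"
  shows "weigh H (down g) = (\<lambda>x. int q * down (weigh H g) x)"
proof
  fix x
  have e: "int q ^ (rk H - rk x) * g y = int q * weigh H g y" if "y \<in> L" "rk y = Suc (rk x)" for y
  proof (cases "y \<subseteq> H")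
    case True
    then have "rk H - rk x = Suc (rk H - rk y)" using that assms rk_mono[of y H] by auto
    then show ?thesis by (simp add: weigh_def)
  next
    case False
    then show ?thesis using supportedD[OF assms(2)] by (simp add: weigh_def)
  qed
  show "weigh H (down g) x = int q * down (weigh H g) x"
    unfolding weigh_def[of H "down g"] down_def
    by (auto simp: sum_distrib_left e intro!: sum.cong)
qed

lemma weigh_downs:
  assumes "H \<in> L" "supported H g"
  shows "weigh H ((down ^^ i) g) x = int q ^ i * (down ^^ i) (weigh H g) x"
proof (induction i arbitrary: x)
  case (Suc i)
  have "weigh H (down ((down ^^ i) g)) x = int q * down (weigh H ((down ^^ i) g)) x"
    using weigh_down[OF assms(1) supported_downs[OF assms(2)]] by simp
  also have "weigh H ((down ^^ i) g) = (\<lambda>x. int q ^ i * (down ^^ i) (weigh H g) x)"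
    using Suc.IH by auto
  finally show ?case by (simp add: down_scale)
qed simp

text \<open>On pairs, \<open>D (f, g) = (D f + W g, D g)\<close> with \<open>W\<close> the
  weighting. In the coordinates \<open>(f, W g)\<close> this becomes
  \<open>(D f + g, q D g)\<close>, the form used in \<open>pair_lift\<close>.\<close>

lemma down_pair:
  assumes X: "X \<in> L" "H \<in> coatoms X" and f: "supported H f" and g: "supported H g"
  shows "down (\<lambda>x. f x + lift X H g x) x = down f x + weigh H g x + lift X H (down g) x"
proof (cases "x \<subseteq> H")
  case True
  then have "lift X H (down g) x = 0" by (simp add: lift_def)
  moreover have "x \<notin> L \<Longrightarrow> g x = 0" using supportedD[OF g] by blast
  ultimately show ?thesis
    using down_lift_below[OF X g, of x] True
    by (cases "x \<in> L") (auto simp: down_add weigh_def, simp add: down_def)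
next
  case False
  have "X \<inter> H = H" using X by (auto simp: coatoms_def)
  then have "down (lift X H g) x = lift X H (down g) x"
    using down_lift[OF X X(1) order_refl, of g x] g False by simp
  moreover have "weigh H g x = 0" using supportedD[OF g] False by (simp add: weigh_def)
  ultimately show ?thesis by (simp add: down_add)
qed

text \<open>Each exchange of \<open>W\<close> with \<open>D\<close> gives a factor \<open>q\<close>,
  so the mixed terms add up with coefficient \<open>1 + q + ... + q^(i-1)\<close>.\<close>

lemma downs_pair:
  assumes X: "X \<in> L" "H \<in> coatoms X" and f: "supported H f" and g: "supported H g"
  shows "(down ^^ i) (\<lambda>x. f x + lift X H g x) =
    (\<lambda>x. (down ^^ i) f x + int (gauss_int q i) * (down ^^ (i - 1)) (weigh H g) x +
      lift X H ((down ^^ i) g) x)"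
proof (induction i)
  case (Suc i)
  let ?F = "\<lambda>x. (down ^^ i) f x + int (gauss_int q i) * (down ^^ (i - 1)) (weigh H g) x"
  have H: "H \<in> L" using X by (auto simp: coatoms_def)
  have F: "supported H ?F"
    by (intro supported_add supported_scale supported_downs supported_weigh f g)
  \<comment> \<open>At \<open>i = 0\<close> the exponent \<open>i - 1\<close> is truncated, but then
    the coefficient is 0.\<close>
  have d: "int (gauss_int q i) * down ((down ^^ (i - 1)) (weigh H g)) x =
      int (gauss_int q i) * (down ^^ i) (weigh H g) x" for x
  proof (cases i)
    case 0
    then show ?thesis by simp
  next
    case (Suc k)
    then show ?thesis by simp
  qed
  show ?case
  proof
    fix x
    have "(down ^^ Suc i) (\<lambda>x. f x + lift X H g x) x =
        down (\<lambda>x. ?F x + lift X H ((down ^^ i) g) x) x"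
      by (simp add: Suc.IH)
    also have "\<dots> = down ?F x + weigh H ((down ^^ i) g) x + lift X H (down ((down ^^ i) g)) x"
      using supported_downs[OF g] by (intro down_pair X F)
    also have "down ?F x = down ((down ^^ i) f) x +
        int (gauss_int q i) * (down ^^ i) (weigh H g) x"
      by (simp only: down_add down_scale d)
    also have "weigh H ((down ^^ i) g) x = int q ^ i * (down ^^ i) (weigh H g) x"
      by (rule weigh_downs[OF H g])
    finally show "(down ^^ Suc i) (\<lambda>x. f x + lift X H g x) x =
        (down ^^ Suc i) f x + int (gauss_int q (Suc i)) * (down ^^ (Suc i - 1)) (weigh H g) x +
        lift X H ((down ^^ Suc i) g) x"
      by (simp add: algebra_simps)
  qed
qed simp

text \<open>Up to the factor \<open>q\<close>, this is the sum of \<open>u\<close> over the \<open>x \<subseteq> Y\<close> outside \<open>H\<close> with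
  \<open>x \<inter> H = w\<close>, minus its average over the hyperplanes \<open>Y' \<noteq> H\<close> with \<open>Y' \<inter> H = Y \<inter> H\<close>. Without the
  subtraction it would not commute with \<^const>\<open>down\<close>.\<close>

definition excess :: "'v set \<Rightarrow> 'v set \<Rightarrow> 'v set \<Rightarrow> ('v set \<Rightarrow> int) \<Rightarrow> 'v set \<Rightarrow> int" where
  "excess X H Y u w = (if w \<in> L \<and> w \<subseteq> Y \<inter> H then
     \<Sum>x | x \<in> L \<and> x \<subseteq> X \<and> \<not> x \<subseteq> H \<and> x \<inter> H = w. ((if x \<subseteq> Y then int q else 0) - 1) * u x
   else 0)"

text \<open>Both sides sum over the \<open>x\<close> outside \<open>H\<close> two ranks above
  \<open>z\<close>. On the left the coefficient of \<open>u x\<close> is the sum of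
  \<open>cf y\<close> over the \<open>y\<close> between; it must be \<open>q * cf x\<close> if the
  trace of \<open>x\<close> lies in \<open>Y\<close>, and 0 otherwise.\<close>

lemma excess_down:
  assumes X: "X \<in> L" "H \<in> coatoms X" and Y: "Y \<in> coatoms X" "Y \<noteq> H" and u: "supported X u"
  shows "excess X H Y (down u) z = int q * down (excess X H Y u) z"
proof (cases "z \<in> L \<and> z \<subseteq> Y \<inter> H")
  case False
  have "excess X H Y u w = 0" if "z \<in> L" "z \<subseteq> w" for w
  proof -
    have "\<not> w \<subseteq> Y \<inter> H" using False that by blast
    then show ?thesis unfolding excess_def by (intro if_not_P) blast
  qed
  then have "down (excess X H Y u) z = 0"
    unfolding down_def by (auto intro!: sum.neutral)
  moreover have "excess X H Y (down u) z = 0"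
    unfolding excess_def using False by (rule if_not_P)
  ultimately show ?thesis by simp
next
  case True
  have H: "H \<in> L" "H \<subseteq> X" and YL: "Y \<in> L" "Y \<subseteq> X" using X Y by (auto simp: coatoms_def)
  define cf where "cf x = (if x \<subseteq> Y then int q else 0) - 1" for x
  define N where "N w = {x \<in> L. x \<subseteq> X \<and> \<not> x \<subseteq> H \<and> x \<inter> H = w}" for w
  define S where "S = {x \<in> L. x \<subseteq> X \<and> \<not> x \<subseteq> H \<and> z \<subseteq> x \<and> rk x = Suc (Suc (rk z))}"
  have fin [simp]: "finite (N w)" "finite S" for w by (auto simp: N_def S_def)
  have rN: "y \<in> L \<Longrightarrow> y \<subseteq> X \<Longrightarrow> \<not> y \<subseteq> H \<Longrightarrow> rk y = Suc (rk (y \<inter> H))" for y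
    by (rule rk_inter_coatom[OF X])
  have ex: "excess X H Y v w = (\<Sum>x\<in>N w. cf x * v x)" if "w \<in> L" "w \<subseteq> Y \<inter> H" for v w
    using that by (simp add: excess_def N_def cf_def)
  have "excess X H Y (down u) z = (\<Sum>y\<in>N z. \<Sum>x\<in>{x \<in> S. y \<subseteq> x}. cf y * u x)"
    unfolding ex[OF conjunct1[OF True] conjunct2[OF True]]
  proof (rule sum.cong[OF refl])
    fix y assume y: "y \<in> N z"
    then have yp: "y \<in> L" "\<not> y \<subseteq> H" "z \<subseteq> y" "rk y = Suc (rk z)"
      using rN[of y] by (auto simp: N_def)
    have "down u y = (\<Sum>x\<in>{x \<in> S. y \<subseteq> x}. u x)"
      unfolding down_def using yp supportedD[OF u]
      by (auto simp: S_def intro!: sum.mono_neutral_right)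
    then show "cf y * down u y = (\<Sum>x\<in>{x \<in> S. y \<subseteq> x}. cf y * u x)"
      by (simp add: sum_distrib_left)
  qed
  also have "\<dots> = (\<Sum>x\<in>S. \<Sum>y\<in>{y \<in> N z. y \<subseteq> x}. cf y * u x)"
    by (rule sum.swap_restrict) auto
  also have "\<dots> = (\<Sum>x\<in>S. int q * (if x \<inter> H \<subseteq> Y then cf x * u x else 0))"
  proof (rule sum.cong[OF refl])
    fix x assume "x \<in> S"
    then have x: "x \<in> L" "x \<subseteq> X" "\<not> x \<subseteq> H" "z \<subseteq> x" "rk x = Suc (Suc (rk z))"
      by (auto simp: S_def)
    have c: "card {y \<in> N z. y \<subseteq> W} = q ^ e"
      if "W \<in> L" "W \<subseteq> X" "\<not> W \<subseteq> H" "z \<subseteq> W" "rk W = Suc (rk z + e)" for W e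
    proof -
      have "{y \<in> N z. y \<subseteq> W} = {y \<in> L. y \<subseteq> W \<and> \<not> y \<subseteq> H \<and> y \<inter> H = z}"
        using that by (auto simp: N_def)
      then show ?thesis using card_lifts[OF X, of W z e] that True by simp
    qed
    have c1: "card {y \<in> N z. y \<subseteq> x} = q" using c[of x 1] x by simp
    \<comment> \<open>Of the \<open>q\<close> elements \<open>y\<close> below \<open>x\<close>,
      those inside \<open>Y\<close> number \<open>q\<close>, 0 or 1: if
      \<open>x \<subseteq> Y\<close>, if \<open>H\<close> and \<open>Y\<close> cut \<open>x\<close>
      in the same set, and in the remaining case. There \<open>q * 1 - q = 0\<close>, the
      cancellation for which the average is subtracted.\<close>
    have c2: "int q * int (card {y \<in> N z. y \<subseteq> x \<inter> Y}) - int q =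
        int q * (if x \<inter> H \<subseteq> Y then cf x else 0)"
    proof (cases "x \<subseteq> Y")
      case True
      then have "x \<inter> Y = x" "x \<inter> H \<subseteq> Y" by auto
      then show ?thesis using c1 True by (simp add: cf_def algebra_simps)
    next
      case xY: False
      have xYL: "x \<inter> Y \<in> L" "x \<inter> H \<in> L" using x YL H by (auto intro: inter_L)
      have rxY: "rk x = Suc (rk (x \<inter> Y))"
        using rk_inter_coatom[OF X(1) Y(1), of x] x xY by auto
      have rxH: "rk x = Suc (rk (x \<inter> H))" using rN x by blast
      show ?thesis
      proof (cases "x \<inter> H \<subseteq> Y")
        case True
        then have "x \<inter> H = x \<inter> Y" using rk_eq[of "x \<inter> H" "x \<inter> Y"] xYL rxY rxH by auto
        then have "{y \<in> N z. y \<subseteq> x \<inter> Y} = {}" by (auto simp: N_def)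
        then have "card {y \<in> N z. y \<subseteq> x \<inter> Y} = 0" by (simp only: card.empty)
        then show ?thesis using True xY by (simp add: cf_def)
      next
        case False
        have "\<not> x \<inter> Y \<subseteq> H"
        proof
          assume "x \<inter> Y \<subseteq> H"
          then have "x \<inter> Y = x \<inter> H" using rk_eq[of "x \<inter> Y" "x \<inter> H"] xYL rxY rxH by auto
          then show False using False by auto
        qed
        then have "card {y \<in> N z. y \<subseteq> x \<inter> Y} = 1"
          using c[of "x \<inter> Y" 0] xYL x True rxY by auto
        then show ?thesis using False by simp
      qed
    qed
    have "(\<Sum>y\<in>{y \<in> N z. y \<subseteq> x}. cf y) =
        (\<Sum>y\<in>{y \<in> N z. y \<subseteq> x}. if y \<subseteq> Y then int q else 0) - int (card {y \<in> N z. y \<subseteq> x})"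
      by (simp add: cf_def sum_subtractf)
    also have "(\<Sum>y\<in>{y \<in> N z. y \<subseteq> x}. if y \<subseteq> Y then int q else 0) =
        (\<Sum>y\<in>{y \<in> {y \<in> N z. y \<subseteq> x}. y \<subseteq> Y}. int q)"
      by (rule sum.inter_filter[symmetric]) auto
    also have "{y \<in> {y \<in> N z. y \<subseteq> x}. y \<subseteq> Y} = {y \<in> N z. y \<subseteq> x \<inter> Y}" by auto
    finally have "(\<Sum>y\<in>{y \<in> N z. y \<subseteq> x}. cf y) = int q * (if x \<inter> H \<subseteq> Y then cf x else 0)"
      using c1 c2 by (simp add: mult.commute)
    then show "(\<Sum>y\<in>{y \<in> N z. y \<subseteq> x}. cf y * u x) =
        int q * (if x \<inter> H \<subseteq> Y then cf x * u x else 0)"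
      by (simp add: sum_distrib_right[symmetric])
  qed
  also have "\<dots> = int q * (\<Sum>x\<in>{x \<in> S. x \<inter> H \<subseteq> Y}. cf x * u x)"
    by (simp add: sum_distrib_left[symmetric] sum.inter_filter)
  also have "(\<Sum>x\<in>{x \<in> S. x \<inter> H \<subseteq> Y}. cf x * u x) = down (excess X H Y u) z"
  proof -
    let ?W = "{w \<in> L. z \<subseteq> w \<and> w \<subseteq> Y \<inter> H \<and> rk w = Suc (rk z)}"
    have img: "(\<lambda>x. x \<inter> H) ` {x \<in> S. x \<inter> H \<subseteq> Y} \<subseteq> ?W"
    proof (rule image_subsetI)
      fix x assume "x \<in> {x \<in> S. x \<inter> H \<subseteq> Y}"
      then have x: "x \<in> L" "x \<subseteq> X" "\<not> x \<subseteq> H" "z \<subseteq> x" "rk x = Suc (Suc (rk z))" "x \<inter> H \<subseteq> Y"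
        by (auto simp: S_def)
      then show "x \<inter> H \<in> ?W" using rN[of x] True H by (auto intro: inter_L)
    qed
    have fib: "{x \<in> {x \<in> S. x \<inter> H \<subseteq> Y}. x \<inter> H = w} = N w" if "w \<in> ?W" for w
    proof (rule Set.set_eqI)
      fix x
      show "x \<in> {x \<in> {x \<in> S. x \<inter> H \<subseteq> Y}. x \<inter> H = w} \<longleftrightarrow> x \<in> N w"
      proof (cases "x \<subseteq> H")
        case True
        then show ?thesis by (simp add: S_def N_def)
      next
        case False
        then have "x \<in> L \<Longrightarrow> x \<subseteq> X \<Longrightarrow> rk x = Suc (rk (x \<inter> H))" using rN by blast
        then show ?thesis using that by (auto simp: S_def N_def)
      qed
    qed
    have "down (excess X H Y u) z = (\<Sum>w\<in>?W. excess X H Y u w)"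
      unfolding down_def if_P[OF conjunct1[OF True]]
      by (intro sum.mono_neutral_right) (auto simp: excess_def)
    also have "\<dots> = (\<Sum>w\<in>?W. \<Sum>x\<in>{x \<in> {x \<in> S. x \<inter> H \<subseteq> Y}. x \<inter> H = w}. cf x * u x)"
    proof (rule sum.cong[OF refl])
      fix w assume w: "w \<in> ?W"
      then show "excess X H Y u w = (\<Sum>x\<in>{x \<in> {x \<in> S. x \<inter> H \<subseteq> Y}. x \<inter> H = w}. cf x * u x)"
        unfolding fib[OF w] by (intro ex) auto
    qed
    also have "\<dots> = (\<Sum>x\<in>{x \<in> S. x \<inter> H \<subseteq> Y}. cf x * u x)"
      by (rule sum.group[OF _ _ img]) auto
    finally show ?thesis by simp
  qed
  finally show ?thesis .
qed

lemma excess_downs: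
  assumes X: "X \<in> L" "H \<in> coatoms X" and Y: "Y \<in> coatoms X" "Y \<noteq> H" and u: "supported X u"
  shows "excess X H Y ((down ^^ i) u) z = int q ^ i * (down ^^ i) (excess X H Y u) z"
proof (induction i arbitrary: z)
  case (Suc i)
  have "excess X H Y (down ((down ^^ i) u)) z = int q * down (excess X H Y ((down ^^ i) u)) z"
    by (intro excess_down X Y supported_downs u)
  also have "excess X H Y ((down ^^ i) u) = (\<lambda>z. int q ^ i * (down ^^ i) (excess X H Y u) z)"
    using Suc.IH by auto
  finally show ?case by (simp add: down_scale)
qed simp

lemma excess_chain_space:
  assumes X: "X \<in> L" "H \<in> coatoms X" and u: "u \<in> chain_space X j"
  shows "excess X H Y u \<in> chain_space (Y \<inter> H) (j - 1)"
proof -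
  have "w \<in> L \<and> w \<subseteq> Y \<inter> H \<and> int (rk w) = j - 1" if "excess X H Y u w \<noteq> 0" for w
  proof -
    have w: "w \<in> L" "w \<subseteq> Y \<inter> H" using that by (auto simp: excess_def split: if_splits)
    then have "(\<Sum>x | x \<in> L \<and> x \<subseteq> X \<and> \<not> x \<subseteq> H \<and> x \<inter> H = w.
        ((if x \<subseteq> Y then int q else 0) - 1) * u x) \<noteq> 0"
      using that by (simp add: excess_def)
    then obtain x where x: "x \<in> L" "x \<subseteq> X" "\<not> x \<subseteq> H" "x \<inter> H = w"
      "((if x \<subseteq> Y then int q else 0) - 1) * u x \<noteq> 0"
      by (rule sum.not_neutral_contains_not_neutral) blast
    then have "u x \<noteq> 0" by auto
    then show ?thesis using chain_spaceD[OF u, of x] rk_inter_coatom[OF X, of x] x w by auto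
  qed
  then show ?thesis by (auto simp: chain_space_def)
qed

text \<open>The push-forward along intersection with \<open>H\<close>, as fibre sums rather than
  averages. Its lift is the part of a multiple of \<open>u\<close> that depends on the trace
  alone.\<close>

definition proj :: "'v set \<Rightarrow> 'v set \<Rightarrow> ('v set \<Rightarrow> int) \<Rightarrow> 'v set \<Rightarrow> int" where
  "proj X H u z = (if z \<in> L \<and> z \<subseteq> H then
     \<Sum>x | x \<in> L \<and> x \<subseteq> X \<and> \<not> x \<subseteq> H \<and> x \<inter> H = z. u x else 0)"

lemma proj_chain_space:
  assumes X: "X \<in> L" "H \<in> coatoms X" and u: "u \<in> chain_space X j"
  shows "proj X H u \<in> chain_space H (j - 1)"
proof -
  have "w \<in> L \<and> w \<subseteq> H \<and> int (rk w) = j - 1" if "proj X H u w \<noteq> 0" for w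
  proof -
    have w: "w \<in> L" "w \<subseteq> H" using that by (auto simp: proj_def split: if_splits)
    then have "(\<Sum>x | x \<in> L \<and> x \<subseteq> X \<and> \<not> x \<subseteq> H \<and> x \<inter> H = w. u x) \<noteq> 0"
      using that by (simp add: proj_def)
    then obtain x where x: "x \<in> L" "x \<subseteq> X" "\<not> x \<subseteq> H" "x \<inter> H = w" "u x \<noteq> 0"
      by (rule sum.not_neutral_contains_not_neutral) blast
    then show ?thesis using chain_spaceD[OF u, of x] rk_inter_coatom[OF X, of x] w by auto
  qed
  then show ?thesis by (auto simp: chain_space_def)
qed

lemma lift_chain_space:
  assumes X: "X \<in> L" "H \<in> coatoms X" "Y \<subseteq> X" and g: "g \<in> chain_space K k"
  shows "lift Y H g \<in> chain_space X (k + 1)"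
proof -
  have "x \<in> L \<and> x \<subseteq> X \<and> int (rk x) = k + 1" if "lift Y H g x \<noteq> 0" for x
  proof -
    have x: "x \<in> L" "x \<subseteq> Y" "\<not> x \<subseteq> H" "g (x \<inter> H) \<noteq> 0"
      using that by (auto simp: lift_def split: if_splits)
    then show ?thesis using chain_spaceD[OF g, of "x \<inter> H"] rk_inter_coatom[OF X(1,2), of x] X(3)
      by auto
  qed
  then show ?thesis by (auto simp: chain_space_def)
qed

text \<open>After exchanging the sums, the coefficient of \<open>u x'\<close> is \<open>q\<close>
  times the number of hyperplanes through both \<open>x\<close> and \<open>x'\<close>, minus the
  number through \<open>x\<close>. With \<open>e = rk X - rk x\<close> this is
  \<open>q [e] - [e] = q^e - 1\<close> for \<open>x' = x\<close>, and
  \<open>q [e-1] - [e] = -1\<close> otherwise.\<close>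

lemma sum_lift_excess:
  assumes X: "X \<in> L" "H \<in> coatoms X" and x: "x \<in> L" "x \<subseteq> X" "\<not> x \<subseteq> H"
  shows "(\<Sum>Y\<in>coatoms X - {H}. lift Y H (excess X H Y u) x) =
    int q ^ (rk X - rk x) * u x - proj X H u (x \<inter> H)"
proof -
  have H: "H \<in> L" "H \<subseteq> X" using X by (auto simp: coatoms_def)
  let ?z = "x \<inter> H"
  have z: "?z \<in> L" using x H by (auto intro: inter_L)
  define N where "N = {x' \<in> L. x' \<subseteq> X \<and> \<not> x' \<subseteq> H \<and> x' \<inter> H = ?z}"
  define C where "C = {Y \<in> coatoms X. x \<subseteq> Y}"
  have fin [simp]: "finite N" "finite C" by (auto simp: N_def C_def)
  have rN: "rk x' = Suc (rk ?z)" if "x' \<in> N" for x'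
    using that rk_inter_coatom[OF X, of x'] by (auto simp: N_def)
  have xN: "x \<in> N" using x by (auto simp: N_def)
  have "(\<Sum>Y\<in>coatoms X - {H}. lift Y H (excess X H Y u) x) =
      (\<Sum>Y\<in>C. \<Sum>x'\<in>N. ((if x' \<subseteq> Y then int q else 0) - 1) * u x')"
  proof -
    have "lift Y H (excess X H Y u) x = (if x \<subseteq> Y then excess X H Y u ?z else 0)" for Y
      using x by (simp add: lift_def)
    moreover have "{Y \<in> coatoms X - {H}. x \<subseteq> Y} = C" using x by (auto simp: C_def)
    ultimately have "(\<Sum>Y\<in>coatoms X - {H}. lift Y H (excess X H Y u) x) =
        (\<Sum>Y\<in>C. excess X H Y u ?z)"
      by (simp add: sum.inter_filter[symmetric])
    also have "\<dots> = (\<Sum>Y\<in>C. \<Sum>x'\<in>N. ((if x' \<subseteq> Y then int q else 0) - 1) * u x')"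
    proof (rule sum.cong[OF refl])
      fix Y assume "Y \<in> C"
      then have "?z \<in> L \<and> ?z \<subseteq> Y \<inter> H" using z by (auto simp: C_def)
      then show "excess X H Y u ?z = (\<Sum>x'\<in>N. ((if x' \<subseteq> Y then int q else 0) - 1) * u x')"
        by (simp add: excess_def N_def)
    qed
    finally show ?thesis .
  qed
  also have "\<dots> = (\<Sum>x'\<in>N. \<Sum>Y\<in>C. ((if x' \<subseteq> Y then int q else 0) - 1) * u x')"
    by (rule sum.swap)
  also have "\<dots> = (\<Sum>x'\<in>N. (if x' = x then int q ^ (rk X - rk x) * u x' else 0) - u x')"
  proof (rule sum.cong[OF refl])
    fix x' assume x': "x' \<in> N"
    have cC: "card C = gauss_int q (rk X - rk x)"
      unfolding C_def by (intro card_coatoms x X)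
    have "(\<Sum>Y\<in>C. (if x' \<subseteq> Y then int q else 0) - 1) =
        int q * int (card {Y \<in> C. x' \<subseteq> Y}) - int (card C)"
      by (simp add: sum_subtractf sum.inter_filter[symmetric] mult.commute)
    also have "\<dots> = (if x' = x then int q ^ (rk X - rk x) else 0) - 1"
    proof (cases "x' = x")
      case True
      then have "{Y \<in> C. x' \<subseteq> Y} = C" by (auto simp: C_def)
      moreover have "int (gauss_int q e) * int q + 1 = int (gauss_int q e) + int q ^ e" for e
        using gauss_int_Suc_left[of q e]
        by (metis gauss_int_simps(2) mult.commute of_nat_1 of_nat_add of_nat_mult of_nat_power add.commute)
      ultimately show ?thesis using cC True by (simp add: algebra_simps)
    next
      case False
      have x'p: "x' \<in> L" "x' \<subseteq> X" "x' \<inter> H = ?z" using x' by (auto simp: N_def)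
      let ?j = "jn x x'"
      have j: "?j \<in> L" "?j \<subseteq> X" "x \<union> x' \<subseteq> ?j"
        using x x'p X by (auto intro: jn_L dest: jn_least[of x x' X] jn_upper[of x x'])
      have i: "x \<inter> x' \<in> L" "?z \<subseteq> x \<inter> x'" using x x'p by (auto intro: inter_L)
      \<comment> \<open>Distinct elements with the same trace meet exactly in that trace, so their
        join has rank \<open>rk x + 1\<close>.\<close>
      have "x \<inter> x' \<subset> x"
        using False rk_eq[of x x'] x x'p rN[OF xN] rN[OF x'] by auto
      then have "rk (x \<inter> x') < rk x" using rk_strict i x by blast
      then have "rk (x \<inter> x') = rk ?z" using rN[OF xN] rk_mono[OF z i] by simp
      then have rj: "rk ?j = Suc (rk x)"
        using modular[of x x'] x x'p rN[OF xN] rN[OF x'] by simp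
      have "{Y \<in> C. x' \<subseteq> Y} = {Y \<in> coatoms X. ?j \<subseteq> Y}"
        using j x x'p by (auto simp: C_def coatoms_def dest: jn_least[of x x'])
      then have "card {Y \<in> C. x' \<subseteq> Y} = gauss_int q (rk X - rk ?j)"
        using card_coatoms[OF j(1) X(1) j(2)] by simp
      moreover have "rk X - rk x = Suc (rk X - rk ?j)"
        using rj rk_mono[OF j(1) X(1) j(2)] by simp
      ultimately show ?thesis using cC False
        by (simp add: gauss_int_Suc_left del: gauss_int_simps)
    qed
    finally have e: "(\<Sum>Y\<in>C. (if x' \<subseteq> Y then int q else 0) - 1) =
        (if x' = x then int q ^ (rk X - rk x) else 0) - 1" .
    show "(\<Sum>Y\<in>C. ((if x' \<subseteq> Y then int q else 0) - 1) * u x') =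
        (if x' = x then int q ^ (rk X - rk x) * u x' else 0) - u x'"
      unfolding sum_distrib_right[symmetric] e by (simp add: left_diff_distrib)
  qed
  also have "\<dots> = int q ^ (rk X - rk x) * u x - (\<Sum>x'\<in>N. u x')"
    using xN by (simp add: sum_subtractf)
  also have "(\<Sum>x'\<in>N. u x') = proj X H u ?z"
    using z by (simp add: proj_def N_def)
  finally show ?thesis .
qed

end

section \<open>Almost exactness modulo a prime\<close>

locale modular_geometry_mod = modular_geometry +
  fixes p :: nat
  assumes prime_p: "prime p" and coprime_pq: "coprime p q"
begin

abbreviation per :: nat where "per \<equiv> pi_pq p (int q)"

abbreviation gi :: "nat \<Rightarrow> int" where "gi i \<equiv> int (gauss_int q i)"

lemma per_char: "per = (LEAST r. r > 0 \<and> int p dvd gi r)"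
  unfolding pi_pq_def of_nat_gauss_int cong_0_iff ..

lemma per_pos: "per > 0" and dvd_gi_per: "int p dvd gi per"
proof -
  have "\<exists>r. r > 0 \<and> int p dvd gi r"
    using gauss_int_dvd_exists[OF prime_p coprime_pq] by auto
  from LeastI_ex[OF this] show "per > 0" "int p dvd gi per"
    unfolding per_char by auto
qed

lemma prime_int_p: "prime (int p)"
  using prime_p by simp

lemma not_dvd_q_power: "\<not> int p dvd int q ^ i"
proof -
  have "\<not> p dvd q" using coprime_pq prime_p by (metis coprime_absorb_left not_prime_unit)
  then show ?thesis using prime_int_p by (metis int_dvd_int_iff prime_dvd_power)
qed

text \<open>Minimality of the period; it lets \<open>pair_lift\<close> divide by \<open>[a]\<close>
  and by \<open>[b]\<close>.\<close>

lemma not_dvd_gi: "0 < i \<Longrightarrow> i < per \<Longrightarrow> \<not> int p dvd gi i"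
  using not_less_Least[of i "\<lambda>r. r > 0 \<and> int p dvd gi r"] unfolding per_char by auto

lemma inverse_mod:
  assumes "\<not> int p dvd c"
  obtains c' where "int p dvd c' * c - 1"
proof -
  have "coprime c (int p)" using assms prime_int_p by (metis coprime_commute prime_imp_coprime)
  then obtain c' where "[c * c' = 1] (mod int p)" using cong_solve_coprime_int by blast
  then show ?thesis using that[of c'] by (simp add: cong_iff_dvd_diff mult.commute)
qed

section \<open>Congruence modulo \<open>p\<close>, and \<open>D^per = 0\<close>\<close>

definition eqv :: "('a set \<Rightarrow> int) \<Rightarrow> ('a set \<Rightarrow> int) \<Rightarrow> bool" where
  "eqv f g \<longleftrightarrow> (\<forall>x. int p dvd f x - g x)"

lemma eqvI: "(\<And>x. int p dvd f x - g x) \<Longrightarrow> eqv f g"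
  by (simp add: eqv_def)

lemma eqvD: "eqv f g \<Longrightarrow> int p dvd f x - g x"
  by (simp add: eqv_def)

lemma eqv_refl [simp]: "eqv f f"
  by (simp add: eqv_def)

lemma eqv_trans: "eqv f g \<Longrightarrow> eqv g h \<Longrightarrow> eqv f h"
  unfolding eqv_def
proof
  fix x assume "\<forall>x. int p dvd f x - g x" "\<forall>x. int p dvd g x - h x"
  then have "int p dvd (f x - g x) + (g x - h x)" by (blast intro: dvd_add)
  then show "int p dvd f x - h x" by simp
qed

lemma eqv_sym: "eqv f g \<Longrightarrow> eqv g f"
  unfolding eqv_def by (metis dvd_minus_iff minus_diff_eq)

lemma eqv_down: "eqv f g \<Longrightarrow> eqv (down f) (down g)"
  unfolding eqv_def down_def by (auto simp flip: sum_subtractf intro!: dvd_sum)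

lemma eqv_downs: "eqv f g \<Longrightarrow> eqv ((down ^^ i) f) ((down ^^ i) g)"
  by (induction i) (auto intro: eqv_down)

text \<open>\<open>D^i\<close> sums over saturated chains of length \<open>i\<close> starting at
  \<open>y\<close>, and an interval of length \<open>i\<close> contains
  \<open>[1] [2] ... [i]\<close> of them.\<close>

lemma downs_formula:
  assumes "y \<in> L"
  shows "(down ^^ i) f y =
    (\<Prod>k<i. gi (Suc k)) * (\<Sum>x | x \<in> L \<and> y \<subseteq> x \<and> rk x = rk y + i. f x)"
  using assms
proof (induction i arbitrary: y)
  case 0
  then have "{x \<in> L. y \<subseteq> x \<and> rk x = rk y + 0} = {y}"
    using rk_eq[OF 0] by force
  then show ?case by simp
next
  case (Suc i)
  let ?c = "\<Prod>k<i. gi (Suc k)"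
  let ?A = "{y' \<in> L. y \<subseteq> y' \<and> rk y' = Suc (rk y)}"
  let ?B = "{x \<in> L. y \<subseteq> x \<and> rk x = rk y + Suc i}"
  have "(down ^^ Suc i) f y = (\<Sum>y'\<in>?A. (down ^^ i) f y')"
    using Suc.prems by (simp add: down_def)
  also have "\<dots> = (\<Sum>y'\<in>?A. \<Sum>x\<in>{x \<in> ?B. y' \<subseteq> x}. ?c * f x)"
  proof (rule sum.cong[OF refl])
    fix y' assume y': "y' \<in> ?A"
    then have "{x \<in> L. y' \<subseteq> x \<and> rk x = rk y' + i} = {x \<in> ?B. y' \<subseteq> x}" by auto
    then show "(down ^^ i) f y' = (\<Sum>x\<in>{x \<in> ?B. y' \<subseteq> x}. ?c * f x)"
      using Suc.IH[of y'] y' by (simp add: sum_distrib_left)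
  qed
  also have "\<dots> = (\<Sum>x\<in>?B. \<Sum>y'\<in>{y' \<in> ?A. y' \<subseteq> x}. ?c * f x)"
    by (rule sum.swap_restrict) auto
  also have "\<dots> = (\<Sum>x\<in>?B. (?c * gi (Suc i)) * f x)"
  proof (rule sum.cong[OF refl])
    fix x assume x: "x \<in> ?B"
    have "{y' \<in> ?A. y' \<subseteq> x} = {z \<in> L. y \<subseteq> z \<and> z \<subseteq> x \<and> rk z = Suc (rk y)}" by auto
    then have "card {y' \<in> ?A. y' \<subseteq> x} = gauss_int q (Suc i)"
      using card_atoms[of y x] x Suc.prems by simp
    then show "(\<Sum>y'\<in>{y' \<in> ?A. y' \<subseteq> x}. ?c * f x) = (?c * gi (Suc i)) * f x"
      by (simp del: gauss_int_simps(2))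
  qed
  finally show ?case by (simp add: sum_distrib_left del: gauss_int_simps(2))
qed

lemma downs_per: "eqv ((down ^^ per) f) (\<lambda>x. 0)"
proof (rule eqvI)
  fix y
  obtain k where k: "per = Suc k" using per_pos gr0_implies_Suc by blast
  have "int p dvd (\<Prod>k<per. gi (Suc k))"
    using dvd_gi_per unfolding k by (simp del: gauss_int_simps(2))
  moreover have "y \<notin> L \<Longrightarrow> (down ^^ per) f y = 0"
    unfolding k by (simp add: down_def)
  ultimately show "int p dvd (down ^^ per) f y - 0"
    using downs_formula[of y per f] by (cases "y \<in> L") simp_all
qed

text \<open>Only the inclusion of the kernel in the image; for \<open>a + b = per\<close> the other
  one is \<open>downs_per\<close>.\<close>

definition exact_at :: "'a set \<Rightarrow> nat \<Rightarrow> nat \<Rightarrow> int \<Rightarrow> bool" where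
  "exact_at X a b j \<longleftrightarrow> (\<forall>f \<in> chain_space X j. eqv ((down ^^ a) f) (\<lambda>x. 0) \<longrightarrow>
     (\<exists>g \<in> chain_space X (j + int b). eqv ((down ^^ b) g) f))"

lemma exact_atE:
  assumes "exact_at X a b j" "f \<in> chain_space X j" "eqv ((down ^^ a) f) (\<lambda>x. 0)"
    and "k = j + int b"
  obtains g where "g \<in> chain_space X k" "eqv ((down ^^ b) g) f"
  using assms unfolding exact_at_def by blast

text \<open>For \<open>D (f, g) = (D f + g, q D g)\<close> on pairs, the hypotheses say that \<open>D\<^sup>a (f, g) = 0\<close> and the
  conclusion that \<open>(f, g) = D\<^sup>b (f', g')\<close>.\<close>

lemma pair_lift:
  assumes ab: "a > 0" "b > 0" "a + b = per"
    and f: "f \<in> chain_space H j" and g: "g \<in> chain_space H (j - 1)"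
    and fg: "eqv (\<lambda>x. (down ^^ a) f x + gi a * (down ^^ (a - 1)) g x) (\<lambda>x. 0)"
    and ga: "eqv ((down ^^ a) g) (\<lambda>x. 0)"
    and j: "2 * j + int b \<le> int (rk H) + 1 \<or> 2 * j - int a \<ge> int (rk H) + 1"
    and ex: "\<And>a b j. a + b = per \<Longrightarrow>
      2 * j + int b \<le> int (rk H) \<or> 2 * j - int a \<ge> int (rk H) \<Longrightarrow> exact_at H a b j"
  obtains f' g' where "f' \<in> chain_space H (j + int b)" "g' \<in> chain_space H (j - 1 + int b)"
    "eqv (\<lambda>x. (down ^^ b) f' x + gi b * (down ^^ (b - 1)) g' x) f"
    "eqv (\<lambda>x. int q ^ b * (down ^^ b) g' x) g"
proof -
  obtain a' b' where a': "a = Suc a'" and b': "b = Suc b'"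
    using ab gr0_implies_Suc by metis
  obtain iq where iq: "int p dvd iq * int q ^ b - 1"
    using inverse_mod[OF not_dvd_q_power] by blast
  obtain ib where ib: "int p dvd ib * gi b - 1"
    using inverse_mod[OF not_dvd_gi[of b]] ab by auto
  obtain ia where ia: "int p dvd ia * gi a - 1"
    using inverse_mod[OF not_dvd_gi[of a]] ab by auto
  have split: "gi (x + y) = gi x + int q ^ x * gi y" for x y
    by (induction y) (simp_all add: algebra_simps power_add)
  have qab: "int p dvd gi b + int q ^ b * gi a"
    using dvd_gi_per unfolding split[symmetric] by (simp only: ab(3)[symmetric] add.commute)
  \<comment> \<open>Modulo \<open>p\<close>, \<open>[per] = [b] + q^b [a]\<close> vanishes, so
    \<open>[b] / q^b = -[a]\<close>. This cancels the mixed terms in both cases below.\<close>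
  have key: "int p dvd gi b * iq + gi a"
    by (rule dvd_lin2[OF qab iq, of _ iq "- gi a"]) (simp only: algebra_simps, simp)
  have fg': "int p dvd (down ^^ a) f x + gi a * (down ^^ a') g x" for x
    using eqvD[OF fg, of x] by (simp only: a' diff_Suc_1 diff_zero)
  show ?thesis
    using j
  proof
    assume j: "2 * j + int b \<le> int (rk H) + 1"
    have ex1: "exact_at H a b (j - 1)" by (rule ex) (use ab j in auto)
    obtain g0 where g0: "g0 \<in> chain_space H (j - 1 + int b)"
      and g0e: "eqv ((down ^^ b) g0) g"
      by (rule exact_atE[OF ex1 g ga refl])
    note g0' = eqvD[OF g0e]
    \<comment> \<open>In the lower range \<open>g\<close> can be lifted at once. Adding to
      \<open>f\<close> the mixed term of \<open>g0\<close> turns the first hypothesis into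
      \<open>D^a u = 0\<close>.\<close>
    define u where "u x = f x + gi a * (down ^^ b') g0 x" for x
    have u: "u \<in> chain_space H j"
      unfolding u_def using f g0 b' by (intro chain_space_add chain_space_scale downs_chain_space) auto
    have ua: "eqv ((down ^^ a) u) (\<lambda>x. 0)"
    proof (rule eqvI)
      fix x
      have e: "(down ^^ a) u x = (down ^^ a) f x + gi a * (down ^^ a') ((down ^^ b) g0) x"
        unfolding u_def downs_add downs_scale downs_downs a' b' by simp
      have "int p dvd (down ^^ a') ((down ^^ b) g0) x - (down ^^ a') g x"
        using eqv_downs[of "(down ^^ b) g0" g a'] g0' by (auto simp: eqv_def)
      then show "int p dvd (down ^^ a) u x - 0"
        unfolding e by (rule dvd_lin2[OF fg'[of x], of _ _ 1 "gi a"]) (simp add: algebra_simps)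
    qed
    then have ua': "eqv ((down ^^ Suc a) u) (\<lambda>x. 0)"
      using eqv_down[OF ua] by simp
    have ex2: "exact_at H (Suc a) b' j" by (rule ex) (use ab j b' in auto)
    obtain v where v: "v \<in> chain_space H (j + int b')"
      and ve: "eqv ((down ^^ b') v) u"
      by (rule exact_atE[OF ex2 u ua' refl])
    note v' = eqvD[OF ve]
    have w: "(down ^^ b) v \<in> chain_space H (j - 1)"
      using v b' by (intro downs_chain_space) auto
    have "eqv ((down ^^ a') ((down ^^ b) v)) ((down ^^ a) u)"
      using eqv_downs[of "(down ^^ b') v" u a] v' unfolding downs_downs a' b'
      by (simp add: eqv_def)
    then have wa: "eqv ((down ^^ a') ((down ^^ b) v)) (\<lambda>x. 0)"
      using ua eqv_trans by blast
    have ex3: "exact_at H a' (Suc b) (j - 1)" by (rule ex) (use ab j a' in auto)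
    have deg: "j + int b = j - 1 + int (Suc b)" by simp
    obtain z where z: "z \<in> chain_space H (j + int b)"
      and ze: "eqv ((down ^^ Suc b) z) ((down ^^ b) v)"
      by (rule exact_atE[OF ex3 w wa deg])
    note z' = eqvD[OF ze]
    \<comment> \<open>\<open>v - D z\<close> is killed by \<open>D^b\<close>, so it leaves the
      second component alone. Divided by \<open>[b]\<close>, it adds \<open>u - D^b z\<close> to the
      first component, and taking \<open>f' = z\<close> restores \<open>D^b z\<close>.\<close>
    define g' where "g' x = iq * g0 x + ib * (v x - down z x)" for x
    show ?thesis
    proof (rule that[of z g'])
      show "z \<in> chain_space H (j + int b)" by fact
      have "down z \<in> chain_space H (j - 1 + int b)"
        using down_chain_space[OF z] by (simp add: algebra_simps)
      then show "g' \<in> chain_space H (j - 1 + int b)"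
        unfolding g'_def using g0 v b'
        by (intro chain_space_add chain_space_scale chain_space_diff) (auto simp: algebra_simps)
      show "eqv (\<lambda>x. (down ^^ b) z x + gi b * (down ^^ (b - 1)) g' x) f"
      proof (rule eqvI)
        fix x
        have h: "(down ^^ (b - 1)) g' x =
            iq * (down ^^ b') g0 x + ib * ((down ^^ b') v x - (down ^^ b) z x)"
          unfolding g'_def downs_add downs_scale downs_diff b' by (simp add: funpow_swap1)
        have "(down ^^ b) z x + gi b * (down ^^ (b - 1)) g' x - f x =
            (gi b * iq + gi a) * (down ^^ b') g0 x + ((down ^^ b') v x - u x)
            + (ib * gi b - 1) * ((down ^^ b') v x - (down ^^ b) z x)"
          unfolding h u_def by (simp add: algebra_simps)
        then show "int p dvd (down ^^ b) z x + gi b * (down ^^ (b - 1)) g' x - f x"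
          using key v'[of x] ib by (simp only: dvd_add dvd_mult dvd_mult2)
      qed
      show "eqv (\<lambda>x. int q ^ b * (down ^^ b) g' x) g"
      proof (rule eqvI)
        fix x
        have h: "(down ^^ b) g' x =
            iq * (down ^^ b) g0 x + ib * ((down ^^ b) v x - (down ^^ Suc b) z x)"
          unfolding g'_def downs_add downs_scale downs_diff by (simp add: funpow_swap1)
        have "int q ^ b * (down ^^ b) g' x - g x =
            ((down ^^ b) g0 x - g x) + (iq * int q ^ b - 1) * (down ^^ b) g0 x
            - int q ^ b * ib * ((down ^^ Suc b) z x - (down ^^ b) v x)"
          unfolding h by (simp add: algebra_simps)
        then show "int p dvd int q ^ b * (down ^^ b) g' x - g x"
          using g0'[of x] iq z'[of x] by (simp only: dvd_add dvd_diff dvd_mult dvd_mult2)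
      qed
    qed
  next
    assume j: "2 * j - int a \<ge> int (rk H) + 1"
    \<comment> \<open>In the upper range the bounds do not supply exactness at
      \<open>(a, b, j - 1)\<close>, so \<open>f\<close> is lifted first: applying \<open>D\<close>
      to the first hypothesis produces \<open>D^a g\<close>, which vanishes, and leaves
      \<open>D^(a+1) f = 0\<close>.\<close>
    have fa: "eqv ((down ^^ Suc a) f) (\<lambda>x. 0)"
    proof (rule eqvI)
      fix x
      have "int p dvd (down ^^ Suc a) f x + gi a * (down ^^ a) g x"
        using eqvD[OF eqv_down[OF fg], of x] unfolding down_add down_scale by (simp add: a')
      then show "int p dvd (down ^^ Suc a) f x - 0"
        by (rule dvd_lin2[OF _ eqvD[OF ga, of x], of _ _ 1 "- gi a"]) (simp add: algebra_simps)
    qed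
    have ex2: "exact_at H (Suc a) b' j" by (rule ex) (use ab j b' in auto)
    obtain f1 where f1: "f1 \<in> chain_space H (j + int b')"
      and f1e: "eqv ((down ^^ b') f1) f"
      by (rule exact_atE[OF ex2 f fa refl])
    note f1' = eqvD[OF f1e]
    \<comment> \<open>\<open>w\<close> stands for \<open>D f + [a] g\<close>, whose image under
      \<open>D^(a-1)\<close> is the first hypothesis.\<close>
    define w where "w x = (down ^^ b) f1 x + gi a * g x" for x
    have w: "w \<in> chain_space H (j - 1)"
      unfolding w_def using f1 g b' by (intro chain_space_add chain_space_scale downs_chain_space) auto
    have wa: "eqv ((down ^^ a') w) (\<lambda>x. 0)"
    proof (rule eqvI)
      fix x
      have e: "(down ^^ a') w x = (down ^^ a) ((down ^^ b') f1) x + gi a * (down ^^ a') g x"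
        unfolding w_def downs_add downs_scale downs_downs a' b' by simp
      have "int p dvd (down ^^ a) ((down ^^ b') f1) x - (down ^^ a) f x"
        using eqv_downs[of "(down ^^ b') f1" f a] f1' by (auto simp: eqv_def)
      then show "int p dvd (down ^^ a') w x - 0"
        unfolding e by (rule dvd_lin2[OF fg'[of x], of _ _ 1 1]) (simp add: algebra_simps)
    qed
    have ex3: "exact_at H a' (Suc b) (j - 1)" by (rule ex) (use ab j a' in auto)
    have deg: "j + int b = j - 1 + int (Suc b)" by simp
    obtain g1 where g1: "g1 \<in> chain_space H (j + int b)"
      and g1e: "eqv ((down ^^ Suc b) g1) w"
      by (rule exact_atE[OF ex3 w wa deg])
    note g1' = eqvD[OF g1e]
    \<comment> \<open>Since \<open>D^(b+1) g1 = D^b f1 + [a] g\<close>, this choice gives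
      \<open>D^b g0 = g\<close>; \<open>key\<close> then yields the first component.\<close>
    define g0 where "g0 x = ia * (down g1 x - f1 x)" for x
    define g' where "g' x = iq * g0 x" for x
    show ?thesis
    proof (rule that[of g1 g'])
      show "g1 \<in> chain_space H (j + int b)" by fact
      have "down g1 \<in> chain_space H (j - 1 + int b)"
        using down_chain_space[OF g1] by (simp add: algebra_simps)
      then show "g' \<in> chain_space H (j - 1 + int b)"
        unfolding g'_def g0_def using f1 b'
        by (intro chain_space_scale chain_space_diff) (auto simp: algebra_simps)
      show "eqv (\<lambda>x. (down ^^ b) g1 x + gi b * (down ^^ (b - 1)) g' x) f"
      proof (rule eqvI)
        fix x
        have h: "(down ^^ (b - 1)) g' x = iq * (ia * ((down ^^ b) g1 x - (down ^^ b') f1 x))"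
          unfolding g'_def g0_def downs_scale downs_diff b' by (simp add: funpow_swap1)
        have "(down ^^ b) g1 x + gi b * (down ^^ (b - 1)) g' x - f x =
            (gi b * iq + gi a) * (ia * ((down ^^ b) g1 x - (down ^^ b') f1 x))
            - (ia * gi a - 1) * ((down ^^ b) g1 x - (down ^^ b') f1 x)
            + ((down ^^ b') f1 x - f x)"
          unfolding h by (simp add: algebra_simps)
        then show "int p dvd (down ^^ b) g1 x + gi b * (down ^^ (b - 1)) g' x - f x"
          using key f1'[of x] ia by (simp only: dvd_add dvd_diff dvd_mult dvd_mult2)
      qed
      show "eqv (\<lambda>x. int q ^ b * (down ^^ b) g' x) g"
      proof (rule eqvI)
        fix x
        have h: "(down ^^ b) g' x = iq * (ia * ((down ^^ Suc b) g1 x - (down ^^ b) f1 x))"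
          unfolding g'_def g0_def downs_scale downs_diff by (simp add: funpow_swap1)
        have "int q ^ b * (down ^^ b) g' x - g x =
            (iq * int q ^ b - 1) * (ia * ((down ^^ Suc b) g1 x - (down ^^ b) f1 x))
            + ia * ((down ^^ Suc b) g1 x - w x) + (ia * gi a - 1) * g x"
          unfolding h w_def by (simp add: algebra_simps)
        then show "int p dvd int q ^ b * (down ^^ b) g' x - g x"
          using g1'[of x] iq ia by (simp only: dvd_add dvd_diff dvd_mult dvd_mult2)
      qed
    qed
  qed
qed

lemma eqv_add: "eqv f g \<Longrightarrow> eqv f' g' \<Longrightarrow> eqv (\<lambda>x. f x + f' x) (\<lambda>x. g x + g' x)"
  unfolding eqv_def by (auto simp: add_diff_add)

lemma eqv_scale: "eqv f g \<Longrightarrow> eqv (\<lambda>x. c * f x) (\<lambda>x. c * g x)"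
  unfolding eqv_def by (auto simp: right_diff_distrib[symmetric])

lemma eqv_cancel:
  assumes "\<And>x. \<not> int p dvd c x" "eqv (\<lambda>x. c x * f x) (\<lambda>x. c x * g x)"
  shows "eqv f g"
proof (rule eqvI)
  fix x
  have "int p dvd c x * (f x - g x)" using eqvD[OF assms(2), of x] by (simp add: algebra_simps)
  then show "int p dvd f x - g x" using assms(1)[of x] prime_int_p by (simp add: prime_dvd_mult_iff)
qed

lemma eqv_excess: "eqv u v \<Longrightarrow> eqv (excess X H Y u) (excess X H Y v)"
  unfolding eqv_def excess_def
  by (auto simp flip: sum_subtractf right_diff_distrib intro!: dvd_sum)

lemma excess_0: "excess X H Y (\<lambda>x. 0) = (\<lambda>x. 0)"
  by (auto simp: excess_def)

lemma eqv_lift: "eqv u v \<Longrightarrow> eqv (lift Y H u) (lift Y H v)"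
  unfolding eqv_def lift_def by auto

text \<open>A multiple of \<open>f\<close> is changed by an image \<open>D^b U\<close> until,
  outside \<open>H\<close>, it depends only on the trace in \<open>H\<close>. What remains is a
  pair, and \<open>pair_lift\<close> applies once its second entry is weighted. \<open>U\<close>
  comes from exactness on the various \<open>Y \<inter> H\<close>.\<close>

lemma exact_at_step:
  assumes X: "X \<in> L" "H \<in> coatoms X"
    and exH: "\<And>a b j. a + b = per \<Longrightarrow>
      2 * j + int b \<le> int (rk H) \<or> 2 * j - int a \<ge> int (rk H) \<Longrightarrow> exact_at H a b j"
    and exY: "\<And>Y. Y \<in> coatoms X \<Longrightarrow> Y \<noteq> H \<Longrightarrow> exact_at (Y \<inter> H) a b (j - 1)"
    and ab: "a > 0" "b > 0" "a + b = per"
    and j: "2 * j + int b \<le> int (rk X) \<or> 2 * j - int a \<ge> int (rk X)"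
  shows "exact_at X a b j"
  unfolding exact_at_def
proof (intro ballI impI)
  fix f assume f: "f \<in> chain_space X j" and fa: "eqv ((down ^^ a) f) (\<lambda>x. 0)"
  have H: "H \<in> L" "H \<subseteq> X" "rk X = Suc (rk H)" and XH: "X \<inter> H = H"
    using X by (auto simp: coatoms_def)
  have sf: "supported X f" using f by (rule chain_space_supported)
  have "\<exists>v. v \<in> chain_space (Y \<inter> H) (j - 1 + int b) \<and> eqv ((down ^^ b) v) (excess X H Y f)"
    if Y: "Y \<in> coatoms X" "Y \<noteq> H" for Y
  proof -
    have "eqv (\<lambda>z. int q ^ a * (down ^^ a) (excess X H Y f) z) (\<lambda>z. int q ^ a * 0)"
      using eqv_excess[OF fa, of X H Y] excess_downs[OF X Y sf, of a]
      by (simp add: excess_0 eqv_def)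
    then have "eqv ((down ^^ a) (excess X H Y f)) (\<lambda>z. 0)"
      by (rule eqv_cancel[rotated]) (rule not_dvd_q_power)
    from exact_atE[OF exY[OF Y] excess_chain_space[OF X f] this refl] show ?thesis by blast
  qed
  then obtain V where V: "\<And>Y. Y \<in> coatoms X \<Longrightarrow> Y \<noteq> H \<Longrightarrow>
      V Y \<in> chain_space (Y \<inter> H) (j - 1 + int b) \<and> eqv ((down ^^ b) (V Y)) (excess X H Y f)"
    by metis
  define U where "U x = (\<Sum>Y\<in>coatoms X - {H}. lift Y H (V Y) x)" for x
  have chain_sum: "(\<lambda>x. \<Sum>Y\<in>A. F Y x) \<in> chain_space X k"
    if "\<And>Y. Y \<in> A \<Longrightarrow> F Y \<in> chain_space X k" for A :: "'a set set" and F k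
    using that unfolding chain_space_def mem_Collect_eq
    by (meson sum.not_neutral_contains_not_neutral)
  have U: "U \<in> chain_space X (j + int b)"
    unfolding U_def
  proof (rule chain_sum)
    fix Y assume "Y \<in> coatoms X - {H}"
    then have "Y \<subseteq> X" "V Y \<in> chain_space (Y \<inter> H) (j - 1 + int b)"
      using V by (auto simp: coatoms_def)
    from lift_chain_space[OF X this] show "lift Y H (V Y) \<in> chain_space X (j + int b)"
      by (simp add: algebra_simps)
  qed
  \<comment> \<open>The factor \<open>q^(rk X - rk x)\<close> in \<open>sum_lift_excess\<close> is
    the constant \<open>q^s\<close> on the support of \<open>f\<close>, where
    \<open>rk x = j\<close>.\<close>
  define s where "s = nat (int (rk X) - j)"
  define u where "u x = int q ^ s * f x - (down ^^ b) U x" for x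
  have u: "u \<in> chain_space X j"
    unfolding u_def using f U by (intro chain_space_diff chain_space_scale downs_chain_space) auto
  have ua: "eqv ((down ^^ a) u) (\<lambda>x. 0)"
  proof (rule eqvI)
    fix x
    have "(down ^^ a) u x = int q ^ s * (down ^^ a) f x - (down ^^ per) U x"
      unfolding u_def downs_diff downs_scale downs_downs ab ..
    then show "int p dvd (down ^^ a) u x - 0"
      using eqvD[OF fa, of x] eqvD[OF downs_per, of U x] by simp
  qed
  define g where "g = proj X H f"
  define h where "h x = (if x \<subseteq> H then u x else 0)" for x
  have g: "g \<in> chain_space H (j - 1)" unfolding g_def by (rule proj_chain_space[OF X f])
  have h: "h \<in> chain_space H j"
    using u by (auto simp: h_def chain_space_def)
  note sg = chain_space_supported[OF g] and sh = chain_space_supported[OF h]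
  have uhg: "eqv u (\<lambda>x. h x + lift X H g x)"
  proof (rule eqvI)
    fix x
    consider "x \<subseteq> H" | "\<not> (x \<in> L \<and> x \<subseteq> X)" | "\<not> x \<subseteq> H" "x \<in> L" "x \<subseteq> X" by blast
    then show "int p dvd u x - (h x + lift X H g x)"
    proof cases
      case 1
      then show ?thesis by (simp add: h_def lift_def)
    next
      case 2
      then show ?thesis
        using supportedD[OF chain_space_supported[OF u]] by (auto simp: h_def lift_def)
    next
      case 3
      have "(down ^^ b) U x = (\<Sum>Y\<in>coatoms X - {H}. (down ^^ b) (lift Y H (V Y)) x)"
        unfolding U_def downs_sum ..
      also have "\<dots> = (\<Sum>Y\<in>coatoms X - {H}. lift Y H ((down ^^ b) (V Y)) x)"
      proof (rule sum.cong[OF refl])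
        fix Y assume Y: "Y \<in> coatoms X - {H}"
        then have "Y \<in> L" "Y \<subseteq> X" by (auto simp: coatoms_def)
        then show "(down ^^ b) (lift Y H (V Y)) x = lift Y H ((down ^^ b) (V Y)) x"
          using V Y 3 by (intro downs_lift[OF X]) (auto intro: chain_space_supported)
      qed
      finally have "(down ^^ b) U x - (\<Sum>Y\<in>coatoms X - {H}. lift Y H (excess X H Y f) x) =
          (\<Sum>Y\<in>coatoms X - {H}.
            lift Y H ((down ^^ b) (V Y)) x - lift Y H (excess X H Y f) x)"
        by (simp add: sum_subtractf)
      moreover have "int p dvd \<dots>"
        by (rule dvd_sum, rule eqvD, rule eqv_lift) (use V in simp)
      ultimately have "int p dvd (down ^^ b) U x -
          (\<Sum>Y\<in>coatoms X - {H}. lift Y H (excess X H Y f) x)" by simp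
      moreover have "int q ^ (rk X - rk x) * f x = int q ^ s * f x"
        using chain_spaceD[OF f, of x] rk_mono[of x X] X by (cases "f x = 0") (auto simp: s_def nat_diff_distrib')
      ultimately have "int p dvd (down ^^ b) U x - (int q ^ s * f x - g (x \<inter> H))"
        using sum_lift_excess[OF X 3(2,3,1)] by (simp add: g_def)
      moreover have "u x - (h x + lift X H g x) =
          - ((down ^^ b) U x - (int q ^ s * f x - g (x \<inter> H)))"
        using 3 by (simp add: u_def h_def lift_def)
      ultimately show ?thesis by (simp only: dvd_minus_iff)
    qed
  qed
  have zero: "int p dvd (down ^^ a) h x + gi a * (down ^^ (a - 1)) (weigh H g) x +
      lift X H ((down ^^ a) g) x" for x
    using eqvD[OF eqv_trans[OF eqv_sym[OF eqv_downs[OF uhg]] ua], of x]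
    unfolding downs_pair[OF X sh sg] by simp
  \<comment> \<open>The first two terms live inside \<open>H\<close> and the lift outside, so
    \<open>zero\<close> splits into one condition on each component.\<close>
  have off: "(down ^^ a) h x + gi a * (down ^^ (a - 1)) (weigh H g) x = 0" if "\<not> x \<subseteq> H" for x
    using that supportedD[OF supported_downs[OF sh]]
      supportedD[OF supported_downs[OF supported_weigh[OF sg]]] by simp
  have z1: "eqv (\<lambda>x. (down ^^ a) h x + gi a * (down ^^ (a - 1)) (weigh H g) x) (\<lambda>x. 0)"
  proof (rule eqvI)
    fix x
    show "int p dvd (down ^^ a) h x + gi a * (down ^^ (a - 1)) (weigh H g) x - 0"
      using zero[of x] off[of x] by (cases "x \<subseteq> H") (simp_all add: lift_def)
  qed
  have z2: "eqv ((down ^^ a) g) (\<lambda>x. 0)"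
  proof (rule eqvI)
    fix z
    show "int p dvd (down ^^ a) g z - 0"
    proof (cases "z \<in> L \<and> z \<subseteq> H")
      case False
      then have "(down ^^ a) g z = 0" using supportedD[OF supported_downs[OF sg]] by blast
      then show ?thesis by simp
    next
      case True
      \<comment> \<open>The lift reveals \<open>g z\<close> only if \<open>z\<close> is the trace of
        some \<open>x\<close> outside \<open>H\<close>; such \<open>x\<close> exist because
        \<open>q^e\<close> is positive.\<close>
      have "card {x \<in> L. x \<subseteq> X \<and> \<not> x \<subseteq> H \<and> x \<inter> H = z} = q ^ (rk H - rk z)"
        using True H X rk_mono[of z H] rk_mono[of X H] by (intro card_lifts[OF X]) auto
      then have "{x \<in> L. x \<subseteq> X \<and> \<not> x \<subseteq> H \<and> x \<inter> H = z} \<noteq> {}"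
        using q_pos by (metis card.empty power_not_zero less_numeral_extra(3))
      then obtain x where "x \<in> L" "x \<subseteq> X" "\<not> x \<subseteq> H" "x \<inter> H = z" by blast
      then show ?thesis using zero[of x] off[of x] by (simp add: lift_def)
    qed
  qed
  have "eqv ((down ^^ a) (weigh H g)) (\<lambda>x. 0)"
  proof (rule eqv_cancel)
    show "eqv (\<lambda>x. int q ^ a * (down ^^ a) (weigh H g) x) (\<lambda>x. int q ^ a * 0)"
      using eqv_scale[OF z2] unfolding weigh_downs[OF H(1) sg, symmetric]
      by (auto simp: eqv_def weigh_def)
  qed (rule not_dvd_q_power)
  moreover have "2 * j + int b \<le> int (rk H) + 1 \<or> 2 * j - int a \<ge> int (rk H) + 1"
  proof -
    have e: "int (rk X) = int (rk H) + 1" using H by simp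
    show ?thesis using j unfolding e .
  qed
  ultimately obtain f' g' where f': "f' \<in> chain_space H (j + int b)"
    and g': "g' \<in> chain_space H (j - 1 + int b)"
    and fg: "eqv (\<lambda>x. (down ^^ b) f' x + gi b * (down ^^ (b - 1)) g' x) h"
    and gg: "eqv (\<lambda>x. int q ^ b * (down ^^ b) g' x) (weigh H g)"
    using pair_lift[OF ab h chain_space_weigh[OF g] z1 _ _ exH] by blast
  obtain iq where iq: "int p dvd iq * int q - 1"
    using inverse_mod[of "int q"] not_dvd_q_power[of 1] by auto
  have iqi: "int p dvd iq ^ i * int q ^ i - 1" for i
    using iq by (metis cong_iff_dvd_diff cong_pow power_mult_distrib power_one)
  \<comment> \<open>Undoes the weighting modulo \<open>p\<close>, where powers of \<open>q\<close>
    are invertible.\<close>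
  define g2 where "g2 x = iq ^ (rk H - rk x) * g' x" for x
  have g2: "g2 \<in> chain_space H (j - 1 + int b)"
    using g' by (auto simp: g2_def chain_space_def)
  note sg2 = chain_space_supported[OF g2]
  have wg2: "eqv (weigh H g2) g'"
  proof (rule eqvI)
    fix x
    have "weigh H g2 x - g' x = (iq ^ (rk H - rk x) * int q ^ (rk H - rk x) - 1) * g' x"
      by (simp add: weigh_def g2_def algebra_simps)
    then show "int p dvd weigh H g2 x - g' x" using iqi by simp
  qed
  have g2g: "eqv ((down ^^ b) g2) g"
  proof (rule eqv_cancel)
    have "eqv (weigh H ((down ^^ b) g2)) (weigh H g)"
      using eqv_trans[OF eqv_scale[OF eqv_downs[OF wg2]] gg]
      unfolding weigh_downs[OF H(1) sg2, symmetric] .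
    then show "eqv (\<lambda>x. int q ^ (rk H - rk x) * (down ^^ b) g2 x)
        (\<lambda>x. int q ^ (rk H - rk x) * g x)"
      unfolding weigh_def .
  qed (rule not_dvd_q_power)
  define w where "w x = f' x + lift X H g2 x" for x
  have w: "w \<in> chain_space X (j + int b)"
    unfolding w_def
  proof (rule chain_space_add)
    show "f' \<in> chain_space X (j + int b)" using f' H by (auto simp: chain_space_def)
    show "lift X H g2 \<in> chain_space X (j + int b)"
      using lift_chain_space[OF X order_refl g2] by (simp add: algebra_simps)
  qed
  have "eqv ((down ^^ b) w) u"
  proof -
    have e: "(down ^^ b) w = (\<lambda>x. (down ^^ b) f' x + gi b * (down ^^ (b - 1)) (weigh H g2) x +
        lift X H ((down ^^ b) g2) x)"
      unfolding w_def by (rule downs_pair[OF X chain_space_supported[OF f'] sg2])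
    have "eqv ((down ^^ b) w) (\<lambda>x. (down ^^ b) f' x + gi b * (down ^^ (b - 1)) g' x +
        lift X H g x)"
      unfolding e by (intro eqv_add eqv_scale eqv_refl eqv_downs wg2 eqv_lift g2g)
    moreover have "eqv (\<lambda>x. (down ^^ b) f' x + gi b * (down ^^ (b - 1)) g' x + lift X H g x)
        (\<lambda>x. h x + lift X H g x)"
      by (intro eqv_add fg eqv_refl)
    ultimately have "eqv ((down ^^ b) w) (\<lambda>x. h x + lift X H g x)" by (rule eqv_trans)
    then show ?thesis using eqv_sym[OF uhg] by (rule eqv_trans)
  qed
  then have wu: "int p dvd (down ^^ b) w x - u x" for x by (rule eqvD)
  show "\<exists>g\<in>chain_space X (j + int b). eqv ((down ^^ b) g) f"
  proof (rule bexI[where x = "\<lambda>x. iq ^ s * (w x + U x)"])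
    show "(\<lambda>x. iq ^ s * (w x + U x)) \<in> chain_space X (j + int b)"
      by (intro chain_space_scale chain_space_add w U)
    show "eqv ((down ^^ b) (\<lambda>x. iq ^ s * (w x + U x))) f"
    proof (rule eqvI)
      fix x
      have "(down ^^ b) (\<lambda>x. iq ^ s * (w x + U x)) x - f x =
          iq ^ s * ((down ^^ b) w x - u x) + (iq ^ s * int q ^ s - 1) * f x"
        unfolding downs_scale downs_add u_def by (simp add: algebra_simps)
      then show "int p dvd (down ^^ b) (\<lambda>x. iq ^ s * (w x + U x)) x - f x"
        using wu[of x] iqi[of s] by simp
    qed
  qed
qed

text \<open>The induction generalises over \<open>a\<close>, \<open>b\<close> and \<open>j\<close>,
  because lifting on a hyperplane shifts \<open>a\<close> and \<open>b\<close> by one in opposite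
  directions.\<close>

theorem almost_exact:
  assumes "X \<in> L" "a + b = per"
    and "2 * j + int b \<le> int (rk X) \<or> 2 * j - int a \<ge> int (rk X)"
  shows "exact_at X a b j"
  using assms
proof (induction "rk X" arbitrary: X a b j rule: less_induct)
  case less
  consider "a = 0" | "b = 0" | "a > 0" "b > 0" "rk X = 0" | "a > 0" "b > 0" "rk X > 0"
    by blast
  then show ?case
  proof cases
    case 1
    then show ?thesis
      unfolding exact_at_def by (auto intro!: bexI[of _ "\<lambda>x. 0"] intro: eqv_sym)
  next
    case 2
    have "\<exists>g\<in>chain_space X j. eqv g f" if "f \<in> chain_space X j" for f
      using that by (intro bexI[of _ f]) simp_all
    then show ?thesis using 2 unfolding exact_at_def by simp
  next
    case 3
    \<comment> \<open>With \<open>a, b > 0\<close> and rank 0, either bound excludes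
      \<open>j = 0\<close>, the only degree with nonzero functions.\<close>
    then have j: "j \<noteq> 0" "j < 0 \<or> j > 0" using less.prems by auto
    show ?thesis
      unfolding exact_at_def
    proof (intro ballI impI)
      fix f assume f: "f \<in> chain_space X j"
      have "f x = 0" for x
        using chain_spaceD[OF f, of x] rk_mono[of x X] less.prems 3 j by (cases "f x = 0") auto
      then show "\<exists>g\<in>chain_space X (j + int b). eqv ((down ^^ b) g) f"
        by (intro bexI[of _ "\<lambda>x. 0"]) (auto simp: eqv_def)
    qed
  next
    case 4
    obtain z where z: "z \<in> L" "rk z = 0" "\<forall>x\<in>L. z \<subseteq> x" using bot by blast
    then have "z \<subset> X" using 4 less.prems by auto
    then obtain H where H: "H \<in> coatoms X" using coatom_exists z less.prems by metis
    then have HL: "H \<in> L" "rk X = Suc (rk H)" by (auto simp: coatoms_def)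
    show ?thesis
    proof (rule exact_at_step[OF less.prems(1) H _ _ 4(1,2) less.prems(2,3)])
      show "exact_at H a b j" if "a + b = per"
        "2 * j + int b \<le> int (rk H) \<or> 2 * j - int a \<ge> int (rk H)" for a b j
        using less.hyps[OF _ HL(1) that] HL by simp
    next
      fix Y assume Y: "Y \<in> coatoms X" "Y \<noteq> H"
      then have YL: "Y \<in> L" "Y \<subseteq> X" "rk Y = rk H" using HL by (auto simp: coatoms_def)
      then have "\<not> Y \<subseteq> H" using rk_eq[of Y H] HL Y by auto
      then have r: "rk Y = Suc (rk (Y \<inter> H))"
        using rk_inter_coatom[OF less.prems(1) H] YL by auto
      show "exact_at (Y \<inter> H) a b (j - 1)"
        using r YL HL less.prems by (intro less.hyps inter_L) auto
    qed
  qed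
qed

end

section \<open>Invariants of a group of order prime to $p$\<close>

locale geometry_action = modular_geometry_mod +
  fixes G :: "('g, 'm) monoid_scheme" and \<phi> :: "'g \<Rightarrow> 'a set \<Rightarrow> 'a set" and T :: "'a set"
  assumes group_G: "group G" and finite_G: "finite (carrier G)"
    and coprime_G: "coprime p (card (carrier G))"
    and act_L: "g \<in> carrier G \<Longrightarrow> x \<in> L \<Longrightarrow> \<phi> g x \<in> L"
    and act_mult: "g \<in> carrier G \<Longrightarrow> h \<in> carrier G \<Longrightarrow> x \<in> L \<Longrightarrow>
      \<phi> (g \<otimes>\<^bsub>G\<^esub> h) x = \<phi> g (\<phi> h x)"
    and act_one: "x \<in> L \<Longrightarrow> \<phi> \<one>\<^bsub>G\<^esub> x = x"
    and act_mono: "g \<in> carrier G \<Longrightarrow> x \<in> L \<Longrightarrow> y \<in> L \<Longrightarrow> x \<subseteq> y \<Longrightarrow> \<phi> g x \<subseteq> \<phi> g y"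
    and act_rk: "g \<in> carrier G \<Longrightarrow> x \<in> L \<Longrightarrow> rk (\<phi> g x) = rk x"
    and top: "T \<in> L" "\<And>x. x \<in> L \<Longrightarrow> x \<subseteq> T"
begin

sublocale G: group G by (rule group_G)

lemma act_inv:
  assumes "g \<in> carrier G" "x \<in> L"
  shows "\<phi> (inv\<^bsub>G\<^esub> g) (\<phi> g x) = x" "\<phi> g (\<phi> (inv\<^bsub>G\<^esub> g) x) = x"
  using assms act_mult[of "inv\<^bsub>G\<^esub> g" g x] act_mult[of g "inv\<^bsub>G\<^esub> g" x] act_one by simp_all

text \<open>Pullback along the action, hence a right action on functions; see
  \<open>act_act\<close>.\<close>

definition act :: "'g \<Rightarrow> ('a set \<Rightarrow> int) \<Rightarrow> 'a set \<Rightarrow> int" where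
  "act g f x = (if x \<in> L then f (\<phi> g x) else 0)"

lemma down_act:
  assumes g: "g \<in> carrier G"
  shows "down (act g f) = act g (down f)"
proof
  fix x
  show "down (act g f) x = act g (down f) x"
  proof (cases "x \<in> L")
    case x: True
    have g': "inv\<^bsub>G\<^esub> g \<in> carrier G" using g by simp
    have "bij_betw (\<phi> g) {y \<in> L. x \<subseteq> y \<and> rk y = Suc (rk x)}
        {y \<in> L. \<phi> g x \<subseteq> y \<and> rk y = Suc (rk x)}"
    proof (rule bij_betw_byWitness[where f' = "\<phi> (inv\<^bsub>G\<^esub> g)"])
      show "\<phi> g ` {y \<in> L. x \<subseteq> y \<and> rk y = Suc (rk x)} \<subseteq>
          {y \<in> L. \<phi> g x \<subseteq> y \<and> rk y = Suc (rk x)}"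
        using g x by (auto simp: act_L act_rk dest: act_mono[OF g x])
      show "\<phi> (inv\<^bsub>G\<^esub> g) ` {y \<in> L. \<phi> g x \<subseteq> y \<and> rk y = Suc (rk x)} \<subseteq>
          {y \<in> L. x \<subseteq> y \<and> rk y = Suc (rk x)}"
        using g' act_mono[OF g' act_L[OF g x]] act_inv(1)[OF g x]
        by (auto simp: act_L act_rk)
    qed (use act_inv g in auto)
    from sum.reindex_bij_betw[OF this, of f] show ?thesis
      using x g by (simp add: down_def act_def act_L act_rk)
  qed (simp add: down_def act_def)
qed

lemma downs_act: "g \<in> carrier G \<Longrightarrow> (down ^^ i) (act g f) = act g ((down ^^ i) f)"
  by (induction i) (simp_all add: down_act)

lemma act_chain_space:
  assumes "g \<in> carrier G" "f \<in> chain_space T j"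
  shows "act g f \<in> chain_space T j"
proof -
  have "x \<in> L \<and> x \<subseteq> T \<and> int (rk x) = j" if "act g f x \<noteq> 0" for x
  proof -
    have "x \<in> L" "f (\<phi> g x) \<noteq> 0" using that by (auto simp: act_def split: if_splits)
    then show ?thesis using chain_spaceD[OF assms(2), of "\<phi> g x"] top act_rk[OF assms(1)] by simp
  qed
  then show ?thesis by (auto simp: chain_space_def)
qed

definition fixed_space :: "int \<Rightarrow> ('a set \<Rightarrow> int) set" where
  "fixed_space j = {f \<in> chain_space T j. \<forall>g\<in>carrier G. act g f = f}"

lemma fixed_space_downs:
  "f \<in> fixed_space j \<Longrightarrow> k = j - int i \<Longrightarrow> (down ^^ i) f \<in> fixed_space k"
  by (auto simp: fixed_space_def downs_chain_space downs_act[symmetric])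

lemma fixed_spaceD: "f \<in> fixed_space j \<Longrightarrow> g \<in> carrier G \<Longrightarrow> x \<in> L \<Longrightarrow> f (\<phi> g x) = f x"
proof -
  assume "f \<in> fixed_space j" "g \<in> carrier G" "x \<in> L"
  then have "act g f = f" by (simp add: fixed_space_def)
  from fun_cong[OF this, of x] \<open>x \<in> L\<close> show ?thesis by (simp add: act_def)
qed

lemma act_scale: "act g (\<lambda>x. c * f x) = (\<lambda>x. c * act g f x)"
  by (auto simp: act_def)

lemma act_act:
  assumes "g \<in> carrier G" "h \<in> carrier G"
  shows "act h (act g f) = act (g \<otimes>\<^bsub>G\<^esub> h) f"
  using assms by (auto simp: act_def act_mult act_L)

lemma act_sum: "act h (\<lambda>x. \<Sum>g\<in>A. F g x) = (\<lambda>x. \<Sum>g\<in>A. act h (F g) x)"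
  by (auto simp: act_def)

text \<open>Sum a preimage over \<open>G\<close> and divide by the group order, which is invertible
  modulo \<open>p\<close>. As \<open>f\<close> is fixed exactly and \<open>D\<close> commutes with
  \<open>G\<close>, the sum maps to \<open>card (carrier G)\<close> times \<open>f\<close> modulo
  \<open>p\<close>.\<close>

lemma exact_fixed:
  assumes ab: "a + b = per"
    and j: "2 * j + int b \<le> int (rk T) \<or> 2 * j - int a \<ge> int (rk T)"
    and f: "f \<in> fixed_space j" and fa: "eqv ((down ^^ a) f) (\<lambda>x. 0)"
  obtains h where "h \<in> fixed_space (j + int b)" "eqv ((down ^^ b) h) f"
proof -
  have fc: "f \<in> chain_space T j" using f by (simp add: fixed_space_def)
  obtain h where h: "h \<in> chain_space T (j + int b)" "eqv ((down ^^ b) h) f"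
    by (rule exact_atE[OF almost_exact[OF top(1) ab j] fc fa refl])
  have "\<not> p dvd card (carrier G)"
    using coprime_G prime_p by (metis coprime_absorb_left not_prime_unit)
  then obtain c where c: "int p dvd c * int (card (carrier G)) - 1"
    using inverse_mod[of "int (card (carrier G))"] by auto
  define h' where "h' x = (\<Sum>g\<in>carrier G. act g h x)" for x
  have h'c: "h' \<in> chain_space T (j + int b)"
    using act_chain_space[OF _ h(1)] unfolding h'_def chain_space_def mem_Collect_eq
    by (meson sum.not_neutral_contains_not_neutral)
  have h'i: "act k h' = h'" if k: "k \<in> carrier G" for k
  proof
    fix x
    have "act k h' x = (\<Sum>g\<in>carrier G. act (g \<otimes>\<^bsub>G\<^esub> k) h x)"
      unfolding h'_def act_sum using k by (simp add: act_act)
    also have "\<dots> = h' x"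
      unfolding h'_def
      by (rule sum.reindex_bij_witness[of _ "\<lambda>g. g \<otimes>\<^bsub>G\<^esub> inv\<^bsub>G\<^esub> k" "\<lambda>g. g \<otimes>\<^bsub>G\<^esub> k"])
        (use k in \<open>simp_all add: G.m_assoc\<close>)
    finally show "act k h' x = h' x" .
  qed
  have "h' \<in> fixed_space (j + int b)" using h'c h'i by (simp add: fixed_space_def)
  moreover have "act k (\<lambda>x. c * h' x) = (\<lambda>x. c * h' x)" if "k \<in> carrier G" for k
    by (simp add: act_scale h'i[OF that])
  ultimately have "(\<lambda>x. c * h' x) \<in> fixed_space (j + int b)"
    by (simp add: fixed_space_def chain_space_scale)
  moreover have "eqv ((down ^^ b) (\<lambda>x. c * h' x)) f"
  proof (rule eqvI)
    fix x
    have "int p dvd (\<Sum>g\<in>carrier G. act g ((down ^^ b) h) x - act g f x)"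
      using eqvD[OF h(2)] by (intro dvd_sum) (simp add: act_def)
    moreover have "(\<Sum>g\<in>carrier G. act g ((down ^^ b) h) x - act g f x) =
        (down ^^ b) h' x - int (card (carrier G)) * f x"
      using f unfolding h'_def downs_sum by (simp add: sum_subtractf downs_act fixed_space_def)
    ultimately have "int p dvd (down ^^ b) h' x - int (card (carrier G)) * f x" by simp
    from dvd_lin2[OF this c, of _ c "f x"]
    show "int p dvd (down ^^ b) (\<lambda>x. c * h' x) x - f x"
      unfolding downs_scale by (simp add: algebra_simps)
  qed
  ultimately show ?thesis using that by blast
qed

lemma fixed_space_add:
  assumes "f \<in> fixed_space j" "g \<in> fixed_space j"
  shows "(\<lambda>x. f x + g x) \<in> fixed_space j"
proof -
  have "act k (\<lambda>x. f x + g x) = (\<lambda>x. act k f x + act k g x)" for k by (auto simp: act_def)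
  then show ?thesis using assms by (simp add: fixed_space_def chain_space_add)
qed

lemma fixed_space_diff:
  assumes "f \<in> fixed_space j" "g \<in> fixed_space j"
  shows "(\<lambda>x. f x - g x) \<in> fixed_space j"
proof -
  have "act k (\<lambda>x. f x - g x) = (\<lambda>x. act k f x - act k g x)" for k by (auto simp: act_def)
  then show ?thesis using assms by (simp add: fixed_space_def chain_space_diff)
qed

section \<open>Counting invariant functions modulo \<open>p\<close>\<close>

definition red :: "('a set \<Rightarrow> int) \<Rightarrow> 'a set \<Rightarrow> int" where
  "red f x = f x mod int p"

lemma red_eq_iff: "red f = red g \<longleftrightarrow> eqv f g"
  by (simp add: fun_eq_iff red_def eqv_def mod_eq_dvd_iff)

lemma red_0 [simp]: "red (\<lambda>x. 0) = (\<lambda>x. 0)"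
  by (simp add: red_def fun_eq_iff)

lemma eqv_red: "eqv (red f) f"
  unfolding red_eq_iff[symmetric] by (simp add: red_def fun_eq_iff)

text \<open>Canonical representatives with values in \<open>{0..<p}\<close>: they make the
  invariants modulo \<open>p\<close> a finite set, whose cardinality replaces a dimension.\<close>

definition residue_space :: "int \<Rightarrow> ('a set \<Rightarrow> int) set" where
  "residue_space j = {f \<in> fixed_space j. red f = f}"

definition dmod :: "nat \<Rightarrow> ('a set \<Rightarrow> int) \<Rightarrow> 'a set \<Rightarrow> int" where
  "dmod i f = red ((down ^^ i) f)"

lemma red_fixed_space: "f \<in> fixed_space j \<Longrightarrow> red f \<in> fixed_space j"
proof -
  assume f: "f \<in> fixed_space j"
  have "act g (red f) = red (act g f)" for g by (auto simp: act_def red_def)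
  moreover have "red f \<in> chain_space T j"
  proof -
    have "f x \<noteq> 0" if "red f x \<noteq> 0" for x using that by (auto simp: red_def)
    then show ?thesis using f unfolding fixed_space_def chain_space_def by blast
  qed
  ultimately show ?thesis using f by (simp add: fixed_space_def)
qed

lemma red_residue_space: "f \<in> fixed_space j \<Longrightarrow> red f \<in> residue_space j"
  by (simp add: residue_space_def red_fixed_space) (simp add: red_def fun_eq_iff)

lemma residue_spaceD: "f \<in> residue_space j \<Longrightarrow> f \<in> fixed_space j" "f \<in> residue_space j \<Longrightarrow> red f = f"
  by (auto simp: residue_space_def)

lemma zero_residue_space [simp]: "(\<lambda>x. 0) \<in> residue_space j"
  by (auto simp: residue_space_def fixed_space_def act_def red_def)

lemma dmod_residue_space:
  "f \<in> residue_space j \<Longrightarrow> k = j - int i \<Longrightarrow> dmod i f \<in> residue_space k"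
  unfolding dmod_def by (intro red_residue_space fixed_space_downs) (auto dest: residue_spaceD)

lemma dmod_red: "dmod i (red f) = dmod i f"
  unfolding dmod_def red_eq_iff by (intro eqv_downs eqv_red)

definition orbs :: "int \<Rightarrow> 'a set set set" where
  "orbs j = orbits G {x \<in> L. int (rk x) = j} \<phi>"

lemma finite_orbs: "finite (orbs j)"
proof -
  have "orbs j = orbit G \<phi> ` {x \<in> L. int (rk x) = j}"
    by (auto simp: orbs_def orbits_def)
  then show ?thesis by simp
qed

lemma orbit_act:
  assumes g: "g \<in> carrier G" and x: "x \<in> L"
  shows "orbit G \<phi> (\<phi> g x) = orbit G \<phi> x"
proof
  show "orbit G \<phi> (\<phi> g x) \<subseteq> orbit G \<phi> x"
    using g x by (auto simp: orbit_def act_mult[symmetric])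
  show "orbit G \<phi> x \<subseteq> orbit G \<phi> (\<phi> g x)"
  proof
    fix y assume "y \<in> orbit G \<phi> x"
    then obtain h where h: "h \<in> carrier G" "y = \<phi> h x" by (auto simp: orbit_def)
    then have "y = \<phi> (h \<otimes>\<^bsub>G\<^esub> inv\<^bsub>G\<^esub> g) (\<phi> g x)"
      using g x by (simp add: act_mult act_L act_inv)
    then show "y \<in> orbit G \<phi> (\<phi> g x)" using g h unfolding orbit_def by blast
  qed
qed

text \<open>An invariant function amounts to a free choice of one residue per orbit;
  \<open>\<Psi>\<close> spreads the choice over the orbit.\<close>

lemma card_residue_space: "card (residue_space j) = p ^ card (orbs j)"
  and finite_residue_space [simp]: "finite (residue_space j)"
proof -
  let ?E = "{x \<in> L. int (rk x) = j}"
  let ?P = "orbs j \<rightarrow>\<^sub>E {0..<int p}"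
  define \<Psi> where "\<Psi> F x = (if x \<in> ?E then F (orbit G \<phi> x) else 0)" 
    for F :: "'a set set \<Rightarrow> int" and x
  have orb: "orbit G \<phi> x \<in> orbs j" if "x \<in> ?E" for x
    using that by (auto simp: orbs_def orbits_def)
  have self: "x \<in> orbit G \<phi> x" if "x \<in> L" for x
    using act_one[OF that] unfolding orbit_def by (auto intro!: exI[of _ "\<one>\<^bsub>G\<^esub>"])
  have "inj_on \<Psi> ?P"
  proof (rule inj_onI)
    fix F F' assume F: "F \<in> ?P" "F' \<in> ?P" and eq: "\<Psi> F = \<Psi> F'"
    show "F = F'"
    proof (rule PiE_ext[OF F])
      fix o' assume "o' \<in> orbs j"
      then obtain x where x: "x \<in> ?E" "o' = orbit G \<phi> x" by (auto simp: orbs_def orbits_def)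
      then show "F o' = F' o'" using fun_cong[OF eq, of x] by (simp add: \<Psi>_def)
    qed
  qed
  moreover have "\<Psi> ` ?P = residue_space j"
  proof (intro equalityI subsetI)
    fix f assume "f \<in> \<Psi> ` ?P"
    then obtain F where F: "F \<in> ?P" "f = \<Psi> F" by blast
    have "f \<in> chain_space T j"
      using F top by (auto simp: chain_space_def \<Psi>_def split: if_splits)
    moreover have "act g f = f" if "g \<in> carrier G" for g
      using that F by (auto simp: fun_eq_iff act_def \<Psi>_def act_L act_rk orbit_act)
    moreover have "red f = f"
    proof
      fix x
      show "red f x = f x"
      proof (cases "x \<in> ?E")
        case True
        then have "F (orbit G \<phi> x) \<in> {0..<int p}" using F orb by blast
        then show ?thesis using F True by (simp add: red_def \<Psi>_def)
      next
        case False
        then have "f x = 0" unfolding F \<Psi>_def by (rule if_not_P)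
        then show ?thesis by (simp add: red_def)
      qed
    qed
    ultimately show "f \<in> residue_space j" by (simp add: residue_space_def fixed_space_def)
  next
    fix f assume f: "f \<in> residue_space j"
    note ff = residue_spaceD[OF f]
    have inv: "f y = f x" if "x \<in> L" "y \<in> orbit G \<phi> x" for x y
      using that fixed_spaceD[OF ff(1)] by (auto simp: orbit_def)
    define F where "F = restrict (\<lambda>o'. f (SOME x. x \<in> o')) (orbs j)"
    have Fx: "F (orbit G \<phi> x) = f x" if x: "x \<in> ?E" for x
    proof -
      have "(SOME y. y \<in> orbit G \<phi> x) \<in> orbit G \<phi> x"
        by (rule someI, rule self) (use x in simp)
      then show ?thesis using inv x orb by (simp add: F_def)
    qed
    have rng: "f x \<in> {0..<int p}" for x
    proof -
      have "f x = f x mod int p" using fun_cong[OF ff(2), of x] by (simp add: red_def)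
      also have "\<dots> \<in> {0..<int p}" using prime_gt_0_nat[OF prime_p] by simp
      finally show ?thesis .
    qed
    have "F \<in> ?P" using rng by (auto simp: F_def)
    moreover have "f = \<Psi> F"
    proof
      fix x
      show "f x = \<Psi> F x"
        using Fx[of x] chain_spaceD[of f T j x] ff(1)
        by (cases "x \<in> ?E") (auto simp: \<Psi>_def fixed_space_def)
    qed
    ultimately show "f \<in> \<Psi> ` ?P" by blast
  qed
  ultimately have bij: "bij_betw \<Psi> ?P (residue_space j)" by (simp add: bij_betw_def)
  have "card ?P = p ^ card (orbs j)"
    using finite_orbs by (simp add: card_PiE)
  then show "card (residue_space j) = p ^ card (orbs j)"
    using bij_betw_same_card[OF bij] by simp
  show "finite (residue_space j)"
    using bij_betw_finite[OF bij] finite_orbs by (simp add: finite_PiE)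
qed

text \<open>Rank-nullity in multiplicative form: nonempty fibres of \<open>dmod i\<close> are
  translates of its kernel, reduced again by \<open>red\<close>.\<close>

lemma card_kernel_image:
  "card (residue_space j) =
    card (dmod i ` residue_space j) * card {f \<in> residue_space j. dmod i f = (\<lambda>x. 0)}"
proof -
  let ?A = "residue_space j"
  have fib: "card {f \<in> ?A. dmod i f = y} = card {f \<in> ?A. dmod i f = (\<lambda>x. 0)}"
    if y: "y \<in> dmod i ` ?A" for y
  proof -
    obtain f0 where f0: "f0 \<in> ?A" "y = dmod i f0" using y by blast
    have add: "(\<lambda>x. f x + g x) \<in> fixed_space j" "(\<lambda>x. f x - g x) \<in> fixed_space j"
      if "f \<in> ?A" "g \<in> ?A" for f g
      using that by (auto intro: fixed_space_add fixed_space_diff residue_spaceD)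
    have "bij_betw (\<lambda>f. red (\<lambda>x. f x - f0 x)) {f \<in> ?A. dmod i f = y}
        {f \<in> ?A. dmod i f = (\<lambda>x. 0)}"
    proof (rule bij_betw_byWitness[where f' = "\<lambda>f. red (\<lambda>x. f x + f0 x)"])
      show "\<forall>f\<in>{f \<in> ?A. dmod i f = y}. red (\<lambda>x. red (\<lambda>x. f x - f0 x) x + f0 x) = f"
      proof
        fix f assume "f \<in> {f \<in> ?A. dmod i f = y}"
        then have "red f = f" by (auto dest: residue_spaceD)
        moreover have "red (\<lambda>x. red (\<lambda>x. f x - f0 x) x + f0 x) = red f"
          by (simp add: red_def fun_eq_iff mod_simps)
        ultimately show "red (\<lambda>x. red (\<lambda>x. f x - f0 x) x + f0 x) = f" by simp
      qed
      show "\<forall>f\<in>{f \<in> ?A. dmod i f = (\<lambda>x. 0)}. red (\<lambda>x. red (\<lambda>x. f x + f0 x) x - f0 x) = f"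
      proof
        fix f assume "f \<in> {f \<in> ?A. dmod i f = (\<lambda>x. 0)}"
        then have "red f = f" by (auto dest: residue_spaceD)
        moreover have "red (\<lambda>x. red (\<lambda>x. f x + f0 x) x - f0 x) = red f"
          by (simp add: red_def fun_eq_iff mod_simps)
        ultimately show "red (\<lambda>x. red (\<lambda>x. f x + f0 x) x - f0 x) = f" by simp
      qed
      show "(\<lambda>f. red (\<lambda>x. f x - f0 x)) ` {f \<in> ?A. dmod i f = y} \<subseteq> {f \<in> ?A. dmod i f = (\<lambda>x. 0)}"
      proof (rule image_subsetI)
        fix f assume f: "f \<in> {f \<in> ?A. dmod i f = y}"
        then have "eqv ((down ^^ i) f) ((down ^^ i) f0)"
          using f0 by (simp add: dmod_def red_eq_iff)
        then have "dmod i (\<lambda>x. f x - f0 x) = red (\<lambda>x. 0)"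
          unfolding dmod_def red_eq_iff downs_diff by (simp add: eqv_def)
        then show "red (\<lambda>x. f x - f0 x) \<in> {f \<in> ?A. dmod i f = (\<lambda>x. 0)}"
          using f f0 add by (auto simp: dmod_red intro: red_residue_space)
      qed
      show "(\<lambda>f. red (\<lambda>x. f x + f0 x)) ` {f \<in> ?A. dmod i f = (\<lambda>x. 0)} \<subseteq> {f \<in> ?A. dmod i f = y}"
      proof (rule image_subsetI)
        fix f assume f: "f \<in> {f \<in> ?A. dmod i f = (\<lambda>x. 0)}"
        then have "red ((down ^^ i) f) = red (\<lambda>x. 0)" by (simp add: dmod_def)
        then have "dmod i (\<lambda>x. f x + f0 x) = dmod i f0"
          unfolding dmod_def red_eq_iff downs_add by (simp add: eqv_def)
        then show "red (\<lambda>x. f x + f0 x) \<in> {f \<in> ?A. dmod i f = y}"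
          using f f0 add by (auto simp: dmod_red intro: red_residue_space)
      qed
    qed
    then show ?thesis by (rule bij_betw_same_card)
  qed
  have "card ?A = (\<Sum>y\<in>dmod i ` ?A. card {f \<in> ?A. dmod i f = y})"
    using sum.image_gen[of ?A "\<lambda>_. 1::nat" "dmod i"] by simp
  also have "\<dots> = (\<Sum>y\<in>dmod i ` ?A. card {f \<in> ?A. dmod i f = (\<lambda>x. 0)})"
    by (rule sum.cong[OF refl]) (rule fib)
  finally show ?thesis by simp
qed

lemma card_residue_space_le:
  assumes "a + b = per" "2 * j + int b \<le> int (rk T) \<or> 2 * j - int a \<ge> int (rk T)"
    and "k = j + int b"
  shows "card (residue_space j) \<le> card (dmod a ` residue_space j) * card (dmod b ` residue_space k)"
proof -
  have "{f \<in> residue_space j. dmod a f = (\<lambda>x. 0)} \<subseteq> dmod b ` residue_space k"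
  proof
    fix f assume "f \<in> {f \<in> residue_space j. dmod a f = (\<lambda>x. 0)}"
    then have f: "f \<in> residue_space j" and "red ((down ^^ a) f) = red (\<lambda>x. 0)"
      by (simp_all add: dmod_def)
    then have fa: "eqv ((down ^^ a) f) (\<lambda>x. 0)" unfolding red_eq_iff[symmetric] red_0 by simp
    obtain h where h: "h \<in> fixed_space k" "eqv ((down ^^ b) h) f"
      using exact_fixed[OF assms(1,2) residue_spaceD(1)[OF f] fa] assms(3) by metis
    have "dmod b (red h) = red f" unfolding dmod_red
      unfolding dmod_def red_eq_iff by (rule h(2))
    then have "f = dmod b (red h)" using residue_spaceD(2)[OF f] by simp
    then show "f \<in> dmod b ` residue_space k" using red_residue_space[OF h(1)] by blast
  qed
  then have "card {f \<in> residue_space j. dmod a f = (\<lambda>x. 0)} \<le> card (dmod b ` residue_space k)"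
    by (intro card_mono) auto
  then show ?thesis unfolding card_kernel_image[of j a] by (rule mult_le_mono2)
qed

text \<open>Valid in every degree, since \<open>D^per = 0\<close> puts the image of
  \<open>dmod b\<close> into the kernel of \<open>dmod a\<close>. The opposite estimate
  \<open>card_residue_space_le\<close> rests on exactness.\<close>

lemma card_residue_space_ge:
  assumes "a + b = per" and "k = j + int b"
  shows "card (residue_space j) \<ge> card (dmod a ` residue_space j) * card (dmod b ` residue_space k)"
proof -
  have "dmod b ` residue_space k \<subseteq> {f \<in> residue_space j. dmod a f = (\<lambda>x. 0)}"
  proof (rule image_subsetI)
    fix f assume f: "f \<in> residue_space k"
    have "dmod a (dmod b f) = dmod (a + b) f"
      unfolding dmod_def[of b] dmod_red by (simp add: dmod_def downs_downs)
    also have "\<dots> = red (\<lambda>x. 0)"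
      unfolding dmod_def red_eq_iff assms(1) by (rule downs_per)
    finally have "dmod a (dmod b f) = (\<lambda>x. 0)" by simp
    then show "dmod b f \<in> {f \<in> residue_space j. dmod a f = (\<lambda>x. 0)}"
      using dmod_residue_space[OF f, of j b] assms(2) by simp
  qed
  then have "card (dmod b ` residue_space k) \<le> card {f \<in> residue_space j. dmod a f = (\<lambda>x. 0)}"
    by (intro card_mono) auto
  then show ?thesis unfolding card_kernel_image[of j a] by (rule mult_le_mono2)
qed

section \<open>From cardinalities to wrapped sums of orbit numbers\<close>

lemma rank_orbits_orbs: "rank_orbits G \<phi> L rk k = int (card (orbs k))"
  by (simp add: rank_orbits_def orbs_def)

lemma orbs_empty:
  assumes "k < 0 \<or> k > int (rk T)"
  shows "orbs k = {}"
proof -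
  have "{x \<in> L. int (rk x) = k} = {}" using assms rk_mono[OF _ top(1)] top(2) by fastforce
  then show ?thesis by (simp only: orbs_def orbits_def) blast
qed

lemma residue_space_trivial:
  assumes "k < 0 \<or> k > int (rk T)"
  shows "residue_space k = {\<lambda>x. 0}"
proof -
  have "card (residue_space k) = 1" using card_residue_space[of k] orbs_empty[OF assms] by simp
  then obtain f where "residue_space k = {f}" by (rule card_1_singletonE)
  then show ?thesis using zero_residue_space[of k] by simp
qed

lemma wrapped_eq_sum:
  assumes R: "R \<ge> \<bar>k\<bar> + int (rk T) + 1"
  shows "wrapped (rank_orbits G \<phi> L rk) per k = int (\<Sum>t\<in>{-R..R}. card (orbs (k + t * int per)))"
proof -
  have z: "card (orbs (k + t * int per)) = 0" if "t \<notin> {-R..R}" for t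
  proof -
    have "\<bar>t\<bar> * 1 \<le> \<bar>t\<bar> * int per" using per_pos by (intro mult_left_mono) auto
    moreover have "\<bar>t\<bar> > R" using that by auto
    moreover have "\<bar>t * int per\<bar> = \<bar>t\<bar> * int per" by (simp add: abs_mult)
    ultimately have "\<bar>t * int per\<bar> > \<bar>k\<bar> + int (rk T)" using R by linarith
    then have "k + t * int per < 0 \<or> k + t * int per > int (rk T)" by linarith
    then show ?thesis by (simp add: orbs_empty)
  qed
  have "{t. int (card (orbs (k + t * int per))) \<noteq> 0} \<subseteq> {-R..R}"
  proof (rule subsetI, rule ccontr)
    fix t assume "t \<in> {t. int (card (orbs (k + t * int per))) \<noteq> 0}" "t \<notin> {-R..R}"
    then show False using z[of t] by simp
  qed
  then have "Sum_any (\<lambda>t. int (card (orbs (k + t * int per)))) =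
      (\<Sum>t\<in>{-R..R}. int (card (orbs (k + t * int per))))"
    by (rule Sum_any.expand_superset[rotated]) simp
  then show ?thesis unfolding wrapped_def rank_orbits_orbs by simp
qed

text \<open>The complex alternates \<open>D\<close> from rank \<open>k + t * per\<close> to
  \<open>k - 1 + t * per\<close> with \<open>D^(per-1)\<close> from there to
  \<open>k + (t - 1) * per\<close>. Each term of the second kind is exact, so its size is at most
  the product of the adjacent images \<open>e t\<close> and \<open>c t\<close>; each term of the
  first kind is at least \<open>c t * e (t + 1)\<close>. Multiplying over \<open>t\<close> compares
  the totals.\<close>

lemma wrapped_mono:
  assumes "\<And>t. 2 * (k - 1 + t * int per) + 1 \<le> int (rk T) \<or>
    2 * (k - 1 + t * int per) - int (per - 1) \<ge> int (rk T)"
  shows "wrapped (rank_orbits G \<phi> L rk) per (k - 1) \<le> wrapped (rank_orbits G \<phi> L rk) per k"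
proof -
  define R where "R = \<bar>k\<bar> + int (rk T) + 2"
  let ?B = "\<lambda>t. k - 1 + t * int per" and ?A = "\<lambda>t. k + t * int per"
  define c where "c t = card (dmod 1 ` residue_space (?A t))" for t
  define e where "e t = card (dmod (per - 1) ` residue_space (?B t))" for t
  have per1: "per - 1 + 1 = per" "1 + (per - 1) = per" using per_pos by auto
  have B: "p ^ card (orbs (?B t)) \<le> e t * c t" for t
    using card_residue_space_le[OF per1(1), of "?B t" "?A t"] assms[of t]
    by (simp add: c_def e_def card_residue_space)
  have A: "c t * e (t + 1) \<le> p ^ card (orbs (?A t))" for t
  proof -
    have "?B (t + 1) = ?A t + int (per - 1)" using per_pos by (simp add: algebra_simps)
    from card_residue_space_ge[OF per1(2) this] show ?thesis
      by (simp add: c_def e_def card_residue_space)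
  qed
  have e1: "e t = 1" if "\<bar>t\<bar> \<ge> R" for t
  proof -
    have "\<bar>t\<bar> * 1 \<le> \<bar>t\<bar> * int per" using per_pos by (intro mult_left_mono) auto
    moreover have "\<bar>t * int per\<bar> = \<bar>t\<bar> * int per" by (simp add: abs_mult)
    ultimately have "\<bar>t * int per\<bar> > \<bar>k - 1\<bar> + int (rk T)" using that by (simp add: R_def)
    then have "?B t < 0 \<or> ?B t > int (rk T)" by linarith
    then show ?thesis unfolding e_def by (simp add: residue_space_trivial)
  qed
  \<comment> \<open>The shift moves each \<open>e\<close> to the neighbouring term. The factors lost
    and gained at the ends are 1, since those ranks lie outside the lattice.\<close>
  have shift: "(\<Prod>t\<in>{-R..R}. e (t + 1)) = (\<Prod>t\<in>{-R..R}. e t)"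
  proof -
    have R0: "R \<ge> 0" by (simp add: R_def)
    have "(\<Prod>t\<in>{-R..R}. e (t + 1)) = (\<Prod>t\<in>{-R+1..R+1}. e t)"
      by (rule prod.reindex_bij_witness[of _ "\<lambda>t. t - 1" "\<lambda>t. t + 1"]) auto
    also have "{-R+1..R+1} = insert (R+1) {-R+1..R}" using R0 by auto
    also have "(\<Prod>t\<in>\<dots>. e t) = (\<Prod>t\<in>{-R+1..R}. e t)" using e1[of "R+1"] R0 by simp
    also have "\<dots> = (\<Prod>t\<in>insert (-R) {-R+1..R}. e t)" using e1[of "-R"] R0 by simp
    also have "insert (-R) {-R+1..R} = {-R..R}" using R0 by auto
    finally show ?thesis .
  qed
  have "p ^ (\<Sum>t\<in>{-R..R}. card (orbs (?B t))) = (\<Prod>t\<in>{-R..R}. p ^ card (orbs (?B t)))"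
    by (simp add: power_sum)
  also have "\<dots> \<le> (\<Prod>t\<in>{-R..R}. e t * c t)" by (intro prod_mono) (use B in auto)
  also have "\<dots> = (\<Prod>t\<in>{-R..R}. c t * e (t + 1))"
    by (simp add: prod.distrib shift mult.commute)
  also have "\<dots> \<le> (\<Prod>t\<in>{-R..R}. p ^ card (orbs (?A t)))" by (intro prod_mono) (use A in auto)
  also have "\<dots> = p ^ (\<Sum>t\<in>{-R..R}. card (orbs (?A t)))" by (simp add: power_sum)
  finally have "(\<Sum>t\<in>{-R..R}. card (orbs (?B t))) \<le> (\<Sum>t\<in>{-R..R}. card (orbs (?A t)))"
    using prime_gt_1_nat[OF prime_p] by (simp add: power_increasing_iff)
  moreover have "wrapped (rank_orbits G \<phi> L rk) per k =
      int (\<Sum>t\<in>{-R..R}. card (orbs (?A t)))"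
    by (rule wrapped_eq_sum) (simp add: R_def)
  moreover have "wrapped (rank_orbits G \<phi> L rk) per (k - 1) =
      int (\<Sum>t\<in>{-R..R}. card (orbs (?B t)))"
  proof (rule wrapped_eq_sum)
    show "R \<ge> \<bar>k - 1\<bar> + int (rk T) + 1" unfolding R_def by linarith
  qed
  ultimately show ?thesis by (simp only: of_nat_le_iff)
qed

theorem wrapped_chain_rank_orbits:
  "wrapped_chain (rank_orbits G \<phi> L rk) per (int (rk T div 2)) (per div 2)"
  unfolding wrapped_chain_def
proof (intro conjI allI impI)
  fix i assume i: "i < per div 2"
  define m where "m = int (rk T div 2)"
  define k where "k = m - int i"
  have m: "2 * m \<le> int (rk T)" "int (rk T) \<le> 2 * m + 1"
    unfolding m_def by linarith+
  have ip: "2 * int i + 2 \<le> int per" "int (per - 1) = int per - 1" using i by linarith+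
  \<comment> \<open>For \<open>t \<le> 0\<close> the first bound follows from
    \<open>k \<le> m\<close>. For \<open>t \<ge> 1\<close> the tightest case is
    \<open>t = 1\<close>, which asks for \<open>2 * k - 1 + per \<ge> rk T\<close>. If
    \<open>rk T\<close> is odd this says exactly \<open>2 * i + 2 \<le> per\<close>, the origin of
    \<open>per div 2\<close>.\<close>
  have "2 * (k - 1 + t * int per) + 1 \<le> int (rk T) \<or>
    2 * (k - 1 + t * int per) - int (per - 1) \<ge> int (rk T)" for t
  proof (cases "t \<le> 0")
    case True
    then have "t * int per \<le> 0" by (simp add: mult_nonpos_nonneg)
    then have "2 * (k - 1 + t * int per) + 1 \<le> int (rk T)" 
      using m(1) unfolding k_def distrib_left right_diff_distrib by linarith
    then show ?thesis ..
  next
    case False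
    then have "1 * int per \<le> t * int per" by (intro mult_right_mono) auto
    then have "2 * (k - 1 + t * int per) - int (per - 1) \<ge> int (rk T)"
      using m ip unfolding k_def distrib_left right_diff_distrib by linarith
    then show ?thesis ..
  qed
  then have "wrapped (rank_orbits G \<phi> L rk) per (k - 1) \<le> wrapped (rank_orbits G \<phi> L rk) per k"
    by (rule wrapped_mono)
  then show "wrapped (rank_orbits G \<phi> L rk) per (int (rk T div 2) - int (Suc i)) \<le>
      wrapped (rank_orbits G \<phi> L rk) per (int (rk T div 2) - int i)"
    by (simp add: k_def m_def algebra_simps)
next
  let ?k = "int (rk T div 2) - int (per div 2)"
  show "wrapped (rank_orbits G \<phi> L rk) per ?k \<ge> 0"
    unfolding wrapped_eq_sum[OF order_refl] by (rule of_nat_0_le_iff)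
qed

end

section \<open>Subsets and subspaces\<close>

lemma modular_geometry_Pow:
  fixes S :: "'b set"
  assumes "finite S"
  shows "modular_geometry (Pow S) card (\<union>) 1"
proof
  show "\<exists>z\<in>Pow S. card z = 0 \<and> (\<forall>x\<in>Pow S. z \<subseteq> x)" by (intro bexI[of _ "{}"]) auto
  fix x y assume x: "x \<in> Pow S" and y: "y \<in> Pow S"
  then have fin: "finite x" "finite y" using assms finite_subset by auto
  show "card (x \<union> y) + card (x \<inter> y) = card x + card y"
    using card_Un_Int[OF fin] by simp
  show "x \<subset> y \<Longrightarrow> card x < card y" by (rule psubset_card_mono[OF fin(2)])
  assume xy: "x \<subseteq> y"
  have "{z \<in> Pow S. x \<subseteq> z \<and> z \<subseteq> y \<and> card z = Suc (card x)} = (\<lambda>a. insert a x) ` (y - x)"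
  proof (intro equalityI subsetI)
    fix z assume z: "z \<in> {z \<in> Pow S. x \<subseteq> z \<and> z \<subseteq> y \<and> card z = Suc (card x)}"
    then have "card (z - x) = 1" using fin by (simp add: card_Diff_subset)
    then obtain a where "z - x = {a}" by (rule card_1_singletonE)
    then have "z = insert a x" "a \<in> y - x" using z by auto
    then show "z \<in> (\<lambda>a. insert a x) ` (y - x)" by blast
  next
    fix z assume "z \<in> (\<lambda>a. insert a x) ` (y - x)"
    then show "z \<in> {z \<in> Pow S. x \<subseteq> z \<and> z \<subseteq> y \<and> card z = Suc (card x)}"
      using fin x y xy by auto
  qed
  moreover have "inj_on (\<lambda>a. insert a x) (y - x)" by (auto simp: inj_on_def)
  ultimately have "card {z \<in> Pow S. x \<subseteq> z \<and> z \<subseteq> y \<and> card z = Suc (card x)} = card (y - x)"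
    by (simp add: card_image)
  then show "card {z \<in> Pow S. x \<subseteq> z \<and> z \<subseteq> y \<and> card z = Suc (card x)} =
      gauss_int 1 (card y - card x)"
    using fin xy by (simp add: card_Diff_subset)
qed (use assms in auto)

lemma geometry_action_Pow:
  assumes "subgroup G (sym_group n)" "prime p" "coprime p (card G)"
  shows "geometry_action (Pow {1..n}) card (\<union>) 1 p (sym_group n\<lparr>carrier := G\<rparr>)
    (\<lambda>g A. g ` A) {1..n}"
proof -
  have G: "g permutes {1..n}" if "g \<in> G" for g
    using subgroup.subset[OF assms(1)] that sym_group_carrier by blast
  have "finite G"
    using finite_subset[OF subgroup.subset[OF assms(1)]] finite_permutations[of "{1..n}"]
    by (simp add: sym_group_def)
  moreover have "group (sym_group n\<lparr>carrier := G\<rparr>)"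
    by (rule group.subgroup_imp_group[OF sym_group_is_group assms(1)])
  moreover have "g ` x \<subseteq> {1..n}" if "g \<in> G" "x \<subseteq> {1..n}" for g x
    using that permutes_image[OF G[OF that(1)]] by blast
  moreover have "card (g ` x) = card x" if "g \<in> G" for g x
    using card_image permutes_inj_on[OF G[OF that]] by blast
  ultimately show ?thesis
    using assms
    by (intro geometry_action.intro modular_geometry_mod.intro modular_geometry_Pow
        geometry_action_axioms.intro modular_geometry_mod_axioms.intro)
      (auto simp: sym_group_def image_comp)
qed

text \<open>Serves both to count the covers of a subspace and to show that semilinear bijections
  preserve dimension.\<close>

lemma card_subspace:
  fixes U :: "('a::{field,finite} ^ 'n::finite) set"
  assumes "vec.subspace U"
  shows "card U = CARD('a) ^ vec.dim U"
proof -
  have "card (vec.span B) = CARD('a) ^ card B" if "vec.independent B" for B :: "('a ^ 'n) set"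
  proof -
    have "finite B" by simp
    then show ?thesis using that
    proof (induction B)
      case empty
      then show ?case by simp
    next
      case (insert v B)
      then have ind: "vec.independent B" and v: "v \<notin> vec.span B"
        by (simp_all add: vec.independent_insert)
      have "bij_betw (\<lambda>(c, u). c *s v + u) (UNIV \<times> vec.span B) (vec.span (insert v B))"
        unfolding bij_betw_def
      proof
        show "inj_on (\<lambda>(c, u). c *s v + u) (UNIV \<times> vec.span B)"
        proof (rule inj_onI, clarify)
          fix c u c' u'
          assume u: "u \<in> vec.span B" "u' \<in> vec.span B" and eq: "c *s v + u = c' *s v + u'"
          have "(c - c') *s v = u' - u"
            using eq by (simp add: vec.scale_left_diff_distrib algebra_simps)
          then have m: "(c - c') *s v \<in> vec.span B" using u by (simp add: vec.span_diff)
          have "c = c'"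
          proof (rule ccontr)
            assume "c \<noteq> c'"
            then have "inverse (c - c') *s ((c - c') *s v) = v"
              unfolding vec.scale_scale by simp
            then show False using vec.span_scale[OF m, of "inverse (c - c')"] v by simp
          qed
          then show "c = c' \<and> u = u'" using eq by simp
        qed
        show "(\<lambda>(c, u). c *s v + u) ` (UNIV \<times> vec.span B) = vec.span (insert v B)"
        proof (intro equalityI subsetI)
          fix w assume "w \<in> (\<lambda>(c, u). c *s v + u) ` (UNIV \<times> vec.span B)"
          then obtain c u where "w = c *s v + u" "u \<in> vec.span B" by auto
          then show "w \<in> vec.span (insert v B)"
            unfolding vec.span_breakdown_eq by (intro exI[of _ c]) simp
        next
          fix w assume "w \<in> vec.span (insert v B)"
          then obtain k where "w - k *s v \<in> vec.span B" by (auto simp: vec.span_breakdown_eq)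
          then show "w \<in> (\<lambda>(c, u). c *s v + u) ` (UNIV \<times> vec.span B)"
            by (intro image_eqI[of _ _ "(k, w - k *s v)"]) auto
        qed
      qed
      from bij_betw_same_card[OF this] show ?case
        using insert ind by (simp add: card_cartesian_product)
    qed
  qed
  moreover obtain B where "B \<subseteq> U" "vec.independent B" "vec.span B = U" "card B = vec.dim U"
    using vec.basis_subspace_exists[OF assms] by metis
  ultimately show ?thesis by metis
qed

lemma card_field_gt_1: "CARD('a::{field,finite}) > 1"
proof -
  have "card {0, 1 :: 'a} \<le> CARD('a)" by (intro card_mono) auto
  then show ?thesis by simp
qed

lemma modular_geometry_subspaces:
  "modular_geometry (subspaces :: ('a::{field,finite} ^ 'n::finite) set set) vec.dim
    (\<lambda>x y. {a + b | a b. a \<in> x \<and> b \<in> y}) CARD('a)"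
proof
  let ?q = "CARD('a)"
  show "finite (subspaces :: ('a ^ 'n) set set)" by simp
  show "?q > 0" using card_field_gt_1[where 'a = 'a] by simp
  show "\<exists>z\<in>subspaces. vec.dim z = 0 \<and> (\<forall>x\<in>subspaces. z \<subseteq> (x :: ('a ^ 'n) set))"
    by (rule bexI[of _ "{0}"]) (auto simp: subspaces_def vec.subspace_0 vec.subspace_single_0)
  fix x y :: "('a ^ 'n) set"
  assume x: "x \<in> subspaces" and y: "y \<in> subspaces"
  then have s: "vec.subspace x" "vec.subspace y" by (simp_all add: subspaces_def)
  show "x \<inter> y \<in> subspaces" using s by (simp add: subspaces_def vec.subspace_inter)
  show "{a + b | a b. a \<in> x \<and> b \<in> y} \<in> subspaces"
    using s by (simp add: subspaces_def vec.subspace_sums)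
  show "x \<union> y \<subseteq> {a + b | a b. a \<in> x \<and> b \<in> y}"
  proof
    fix v assume "v \<in> x \<union> y"
    then show "v \<in> {a + b | a b. a \<in> x \<and> b \<in> y}"
      using s[THEN vec.subspace_0] by (metis (mono_tags, lifting) Un_iff add_0 add_0_right mem_Collect_eq)
  qed
  show "{a + b | a b. a \<in> x \<and> b \<in> y} \<subseteq> z" if "z \<in> subspaces" "x \<subseteq> z" "y \<subseteq> z" for z
    using that by (auto simp: subspaces_def intro!: vec.subspace_add)
  show "vec.dim {a + b | a b. a \<in> x \<and> b \<in> y} + vec.dim (x \<inter> y) = vec.dim x + vec.dim y"
    using vec.dim_sums_Int[OF s] by simp
  show "x \<subset> y \<Longrightarrow> vec.dim x < vec.dim y"
    using s by (metis vec.dim_psubset vec.span_eq_iff)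
  assume xy: "x \<subseteq> y"
  let ?d = "vec.dim x"
  let ?A = "{z \<in> subspaces. x \<subseteq> z \<and> z \<subseteq> y \<and> vec.dim z = Suc ?d}"
  obtain e where e: "vec.dim y = ?d + e"
    using vec.dim_subset[OF xy] le_Suc_ex by metis
  have A: "vec.subspace z" "x \<subseteq> z" "z \<subseteq> y" "card z = ?q * ?q ^ ?d" if "z \<in> ?A" for z
    using that card_subspace[of z] by (auto simp: subspaces_def)
  \<comment> \<open>The differences \<open>z - x\<close>, over the covers \<open>z\<close> of
    \<open>x\<close> inside \<open>y\<close>, partition \<open>y - x\<close>. With
    \<open>d = vec.dim x\<close>, their number is \<open>q^(d+e) - q^d\<close> divided by
    \<open>q^(d+1) - q^d\<close>, which is \<open>[e]\<close>.\<close>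
  have cover: "(\<Union>z\<in>?A. z - x) = y - x"
  proof (intro equalityI subsetI)
    fix v assume "v \<in> (\<Union>z\<in>?A. z - x)"
    then show "v \<in> y - x" by blast
  next
    fix v assume v: "v \<in> y - x"
    let ?z = "vec.span (insert v x)"
    have "v \<notin> vec.span x" using v s by (simp add: vec.span_eq_iff[THEN iffD2])
    then have "vec.dim ?z = Suc ?d" by (simp add: vec.dim_insert)
    moreover have "?z \<subseteq> y" using v xy s by (intro vec.span_minimal) auto
    moreover have "x \<subseteq> ?z" "v \<in> ?z" by (auto intro: vec.span_base)
    ultimately show "v \<in> (\<Union>z\<in>?A. z - x)" using v by (auto simp: subspaces_def)
  qed
  have disj: "(z - x) \<inter> (z' - x) = {}" if z: "z \<in> ?A" "z' \<in> ?A" "z \<noteq> z'" for z z'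
  proof (rule ccontr)
    assume "(z - x) \<inter> (z' - x) \<noteq> {}"
    then obtain v where v: "v \<in> z" "v \<in> z'" "v \<notin> x" by blast
    have "v \<notin> vec.span x" using v s by (simp add: vec.span_eq_iff[THEN iffD2])
    then have d: "vec.dim (vec.span (insert v x)) = Suc ?d" by (simp add: vec.dim_insert)
    have eq: "vec.span (insert v x) = w" if w: "w \<in> ?A" "v \<in> w" for w
    proof (rule vec.subspace_dim_equal)
      show "vec.subspace w" by (rule A(1)[OF w(1)])
      show "vec.span (insert v x) \<subseteq> w" using A[OF w(1)] w by (intro vec.span_minimal) auto
      show "vec.dim w \<le> vec.dim (vec.span (insert v x))" using d w by simp
    qed simp
    show False using eq[OF z(1) v(1)] eq[OF z(2) v(2)] z(3) by simp
  qed
  have "card (y - x) = (\<Sum>z\<in>?A. card (z - x))"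
    unfolding cover[symmetric] by (rule card_UN_disjoint) (use disj in auto)
  also have "\<dots> = (\<Sum>z\<in>?A. ?q * ?q ^ ?d - ?q ^ ?d)"
  proof (rule sum.cong[OF refl])
    fix z assume z: "z \<in> ?A"
    then show "card (z - x) = ?q * ?q ^ ?d - ?q ^ ?d"
      using A[OF z] card_subspace[OF s(1)] by (subst card_Diff_subset) auto
  qed
  finally have c: "card (y - x) = card ?A * (?q * ?q ^ ?d - ?q ^ ?d)" by simp
  have "card (y - x) = ?q ^ (?d + e) - ?q ^ ?d"
    using card_subspace[OF s(1)] card_subspace[OF s(2)] xy e by (simp add: card_Diff_subset)
  then have "?q ^ ?d * (card ?A * (?q - 1)) = ?q ^ ?d * (?q ^ e - 1)"
    using c by (simp add: power_add algebra_simps diff_mult_distrib2)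
  then have "card ?A * (?q - 1) = ?q ^ e - 1"
    using card_field_gt_1[where 'a = 'a] by simp
  moreover have "gauss_int ?q e * (?q - 1) = ?q ^ e - 1"
    by (rule gauss_int_mult) (use card_field_gt_1[where 'a = 'a] in simp)
  ultimately have "card ?A * (?q - 1) = gauss_int ?q e * (?q - 1)" by simp
  then show "card ?A = gauss_int ?q (vec.dim y - ?d)"
    using card_field_gt_1[where 'a = 'a] e by simp
qed

lemma geometry_action_subspaces:
  fixes G :: "(('a::{field,finite} ^ 'n::finite) set \<Rightarrow> ('a ^ 'n) set) set"
  assumes "subgroup G PGammaL" "prime p" "coprime p (card G)" "coprime p CARD('a)"
  shows "geometry_action (subspaces :: ('a ^ 'n) set set) vec.dim
    (\<lambda>x y. {a + b | a b. a \<in> x \<and> b \<in> y}) CARD('a) p (PGammaL\<lparr>carrier := G\<rparr>)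
    (\<lambda>g U. g U) UNIV"
proof -
  have G: "\<exists>f. semilinear_bij f \<and> g = restrict (\<lambda>U. f ` U) subspaces" if "g \<in> G" for g
    using subgroup.subset[OF assms(1)] that by (auto simp: PGammaL_def)
  have act: "g U \<in> subspaces" "vec.dim (g U) = vec.dim U"
    if g: "g \<in> G" and U: "U \<in> subspaces" for g U
  proof -
    obtain f where f: "semilinear_bij f" "g U = f ` U" using G[OF g] U by auto
    then show gU: "g U \<in> subspaces" using semilinear_bij_image_subspace U by metis
    \<comment> \<open>As \<open>f\<close> is only semilinear, dimensions are compared through
      cardinalities: an injection preserves \<open>q^dim\<close>, and \<open>q > 1\<close>.\<close>
    have "inj_on f U" using f by (auto simp: semilinear_bij_def bij_def intro: inj_on_subset)
    then have "card (g U) = card U" using f by (simp add: card_image)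
    then have "CARD('a) ^ vec.dim (g U) = CARD('a) ^ vec.dim U"
      using gU U by (simp add: subspaces_def card_subspace)
    then show "vec.dim (g U) = vec.dim U" using card_field_gt_1[where 'a = 'a] by simp
  qed
  have mono: "g x \<subseteq> g y"
    if g: "g \<in> G" and xy: "x \<in> subspaces" "y \<in> subspaces" "x \<subseteq> y" for g x y
  proof -
    obtain f where "g x = f ` x" "g y = f ` y" using G[OF g] xy(1,2) by auto
    then show ?thesis using xy(3) by auto
  qed
  have mult: "(g \<otimes>\<^bsub>PGammaL\<^esub> h) x = g (h x)" if "g \<in> G" "h \<in> G" "x \<in> subspaces" for g h x
  proof -
    have "g \<in> Bij subspaces" "h \<in> Bij subspaces"
      using G that restrict_image_in_Bij by metis+
    then show ?thesis using that by (simp add: PGammaL_def BijGroup_def compose_def)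
  qed
  have "group (PGammaL\<lparr>carrier := G\<rparr>)"
    by (rule group.subgroup_imp_group[OF group_PGammaL assms(1)])
  moreover have "\<one>\<^bsub>PGammaL\<^esub> x = x" if "x \<in> subspaces" for x :: "('a ^ 'n) set"
    using that by (simp add: PGammaL_def BijGroup_def)
  \<comment> \<open>An infinite \<open>G\<close> would have \<open>card G = 0\<close>, which is not
    coprime to a prime.\<close>
  moreover have "finite G"
    using assms(2,3) card.infinite[of G] by (auto simp: not_prime_unit)
  ultimately show ?thesis
    using assms act mono mult
    by (intro geometry_action.intro modular_geometry_mod.intro modular_geometry_subspaces
        geometry_action_axioms.intro modular_geometry_mod_axioms.intro)
      (auto simp: subspaces_def)
qed

theorem theorem4p3:
  fixes n q p :: nat
  assumes "n \<ge> 1"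
    and "q = 1 \<or> primepow q"
    and "Factorial_Ring.prime p"
    and "coprime p q"
  shows
    "(q = 1 \<longrightarrow>
       (\<forall>G. subgroup G (sym_group n) \<and> coprime p (card G) \<longrightarrow>
          wrapped_chain (boolean_orbits n G)
            (pi_pq p (int q)) (int (n div 2)) (pi_pq p (int q) div 2))) \<and>
     (q = CARD('a::{field,finite}) \<and> n = CARD('n::finite) \<longrightarrow>
       (\<forall>G :: (('a ^ 'n) set \<Rightarrow> ('a ^ 'n) set) set.
          subgroup G PGammaL \<and> coprime p (card G) \<longrightarrow>
          wrapped_chain (subspace_orbits G)
            (pi_pq p (int q)) (int (n div 2)) (pi_pq p (int q) div 2)))"
proof (intro conjI impI allI; elim conjE)
  fix G assume q: "q = 1" and G: "subgroup G (sym_group n)" "coprime p (card G)"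
  interpret geometry_action "Pow {1..n}" card "(\<union>)" 1 p "sym_group n\<lparr>carrier := G\<rparr>"
    "\<lambda>g A. g ` A" "{1..n}"
    by (rule geometry_action_Pow[OF G(1) assms(3) G(2)])
  show "wrapped_chain (boolean_orbits n G) (pi_pq p (int q)) (int (n div 2)) (pi_pq p (int q) div 2)"
    using wrapped_chain_rank_orbits unfolding boolean_orbits_def q by simp
next
  fix G :: "(('a ^ 'n) set \<Rightarrow> ('a ^ 'n) set) set"
  assume q: "q = CARD('a)" and n: "n = CARD('n)" and G: "subgroup G PGammaL" "coprime p (card G)"
  interpret geometry_action "subspaces :: ('a ^ 'n) set set" vec.dim
    "\<lambda>x y. {a + b | a b. a \<in> x \<and> b \<in> y}" "CARD('a)" p "PGammaL\<lparr>carrier := G\<rparr>"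
    "\<lambda>g U. g U" UNIV
    using assms(3,4) G q by (intro geometry_action_subspaces) auto
  have "vec.dim (UNIV :: ('a ^ 'n) set) = n" using n by (simp add: vec.dim_UNIV vec.dimension_def card_cart_basis)
  then show "wrapped_chain (subspace_orbits G) (pi_pq p (int q)) (int (n div 2)) (pi_pq p (int q) div 2)"
    using wrapped_chain_rank_orbits unfolding subspace_orbits_def q by simp
qed

end
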